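(* Let $n$ and $m$ be integers with $1\le m\le n$, and let $H^{+}_{n+1}(x,y)$ and $H^{-}_{m+1}(x,y)$ be real homogeneous polynomials of degrees $n+1$ and $m+1$ respectively. Let $X$ be the planar piecewise Hamiltonian system with switching line $y=0$ given by $X=X_+$ for $y\ge 0$ and $X=X_-$ for $y<0$, where $$X_{\pm}:\quad \frac{dx}{dt}=-\frac{\partial H_{\pm}}{\partial y}(x,y),\qquad \frac{dy}{dt}=\frac{\partial H_{\pm}}{\partial x}(x,y),$$ $$H_{+}(x,y)=\frac{x^2+y^2}{2}+H^{+}_{n+1}(x,y),\qquad H_{-}(x,y)=\frac{x^2+y^2}{2}+H^{-}_{m+1}(x,y).$$ If both $n$ and $m$ are odd, then the origin is not an isochronous $\Sigma$-center of $X$.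
   Context: The origin is a $\Sigma$-center of $X$ if it has a neighborhood in which it is surrounded by closed orbits, each formed by a trajectory of $X_+$ in the upper half plane and a trajectory of $X_-$ in the lower half plane. Explicitly: for every sufficiently small $p>0$, the trajectory of $X_+$ starting at $(p,0)$ runs through $\{y>0\}$ until it meets the negative $x$-axis at a point $(\varphi_+(p),0)$, the trajectory of $X_-$ in $\{y<0\}$ that ends at $(p,0)$ starts at a point $(\varphi_-(p),0)$ of the negative $x$-axis, and $\varphi_+(p)=\varphi_-(p)$; the closed orbit $\gamma$ through $(p,0)$ is the union of these two arcs. The period $T(\gamma)$ of such a closed orbit is the sum of the times spent along the $X_+$-arc and the $X_-$-arc. A $\Sigma$-center is isochronous if $T(\gamma)$ is constant, i.e. independent of $\gamma$.
   Formalization: The formal theorem additionally assumes that X_+ and X_- are not both linear; without this the claim fails, e.g. for n=m=1 and H^+_2=H^-_2=x^2+y^2, where both fields are rotations and the origin is an isochronous Σ-center. *)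

theory Defs
  imports "HOL-Analysis.Analysis"
begin

text \<open>
  Real polynomial functions in two variables that are homogeneous of degree \<open>d\<close>; as usual,
  the zero polynomial is homogeneous of every degree.
\<close>

definition homogeneous_polynomial :: "nat \<Rightarrow> (real \<Rightarrow> real \<Rightarrow> real) \<Rightarrow> bool" where
  "homogeneous_polynomial d P \<longleftrightarrow>
     (\<exists>c :: nat \<Rightarrow> real. \<forall>x y. P x y = (\<Sum>i\<le>d. c i * x ^ i * y ^ (d - i)))"

definition hamiltonian_field :: "(real \<Rightarrow> real \<Rightarrow> real) \<Rightarrow> real \<times> real \<Rightarrow> real \<times> real" where
  "hamiltonian_field H = (\<lambda>(x, y). (- deriv (\<lambda>v. H x v) y, deriv (\<lambda>u. H u y) x))"

text \<open>
  \<open>trajectory_arc F U a b T\<close>: the trajectory of \<open>F\<close> starting at \<open>a\<close> stays in \<open>U\<close> until it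
  reaches \<open>b\<close> after the time \<open>T > 0\<close>. The end points \<open>a\<close> and \<open>b\<close> are not required to lie in \<open>U\<close>.
\<close>

definition trajectory_arc ::
  "(real \<times> real \<Rightarrow> real \<times> real) \<Rightarrow> (real \<times> real) set \<Rightarrow> real \<times> real \<Rightarrow> real \<times> real \<Rightarrow> real \<Rightarrow> bool" where
  "trajectory_arc F U a b T \<longleftrightarrow> 0 < T \<and>
     (\<exists>z :: real \<Rightarrow> real \<times> real. z 0 = a \<and> z T = b \<and>
        (\<forall>t\<in>{0..T}. (z has_vector_derivative F (z t)) (at t within {0..T})) \<and>
        (\<forall>t\<in>{0<..<T}. z t \<in> U))"

definition upper_half_plane :: "(real \<times> real) set" where
  "upper_half_plane = {(x, y). y > 0}"

definition lower_half_plane :: "(real \<times> real) set" where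
  "lower_half_plane = {(x, y). y < 0}"

text \<open>
  A piecewise system with switching line \<open>y = 0\<close> is given by its two smooth fields \<open>Xp\<close>
  (for \<open>y \<ge> 0\<close>) and \<open>Xm\<close> (for \<open>y < 0\<close>). They are kept separate, rather than glued to one
  function on the plane, because an arc in the lower half plane is a trajectory of \<open>Xm\<close> up to
  and including its end points on the switching line.

  \<open>closed_orbit Xp Xm p q Tp Tm\<close>: the arc of \<open>Xp\<close> from \<open>(p, 0)\<close> to \<open>(q, 0)\<close>, run through in
  time \<open>Tp\<close>, and the arc of \<open>Xm\<close> from \<open>(q, 0)\<close> to \<open>(p, 0)\<close>, run through in time \<open>Tm\<close>, form a
  closed orbit; \<open>q\<close> is the common value of the two half-return maps at \<open>p\<close>.
\<close>

definition closed_orbit ::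
  "(real \<times> real \<Rightarrow> real \<times> real) \<Rightarrow> (real \<times> real \<Rightarrow> real \<times> real) \<Rightarrow>
   real \<Rightarrow> real \<Rightarrow> real \<Rightarrow> real \<Rightarrow> bool" where
  "closed_orbit Xp Xm p q Tp Tm \<longleftrightarrow> p > 0 \<and> q < 0 \<and>
     trajectory_arc Xp upper_half_plane (p, 0) (q, 0) Tp \<and>
     trajectory_arc Xm lower_half_plane (q, 0) (p, 0) Tm"

definition sigma_center ::
  "(real \<times> real \<Rightarrow> real \<times> real) \<Rightarrow> (real \<times> real \<Rightarrow> real \<times> real) \<Rightarrow> bool" where
  "sigma_center Xp Xm \<longleftrightarrow>
     (\<exists>\<delta>>0. \<forall>p\<in>{0<..<\<delta>}. \<exists>q Tp Tm. closed_orbit Xp Xm p q Tp Tm)"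

definition isochronous_sigma_center ::
  "(real \<times> real \<Rightarrow> real \<times> real) \<Rightarrow> (real \<times> real \<Rightarrow> real \<times> real) \<Rightarrow> bool" where
  "isochronous_sigma_center Xp Xm \<longleftrightarrow> sigma_center Xp Xm \<and>
     (\<exists>\<delta>>0. \<exists>T. \<forall>p\<in>{0<..<\<delta>}. \<forall>q Tp Tm. closed_orbit Xp Xm p q Tp Tm \<longrightarrow> Tp + Tm = T)"

end

theory Submission
  imports Defs "HOL-Complex_Analysis.Complex_Analysis"
begin

text \<open>
  Write \<open>n = 2 k + 1\<close>, \<open>g \<theta> = Hn (cos \<theta>) (sin \<theta>)\<close> and \<open>E = p\<^sup>2 + 2 * g 0 * p ^ (2 * k + 2)\<close>, twice the energy of the orbit
  through \<open>(p, 0)\<close>. Since the Hamiltonians are even, every half orbit runs from \<open>p\<close> to \<open>-p\<close>, and in polar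
  coordinates its time is the integral over \<open>{0..pi}\<close> of a fixed function of \<open>g \<theta> * E ^ k\<close>,
  which is analytic, positive, smaller than 1 at positive arguments, and has an inverse square root
  singularity at a negative critical argument. By analytic continuation in \<open>P = p\<^sup>2\<close>, if the sum of the two half
  periods is constant for small \<open>P\<close>, it stays so until one of the arguments becomes critical. If one of the two
  profiles were negative somewhere, this would happen at some \<open>P > 0\<close>, where the corresponding half period tends to
  infinity: the argument becomes critical at a minimum of the profile, which makes the integral diverge
  logarithmically. So both profiles are nonnegative. But then both half periods are at most \<open>pi\<close>, their
  value at \<open>P = 0\<close>, with equality only for zero profiles.
\<close>

section \<open>The time density along a half orbit\<close>

text \<open>Scaling by \<open>E\<close> leaves the single parameter
  \<open>g \<theta> * E ^ k\<close>, so one function \<open>slowness k\<close> serves all orbits and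
  directions. The dynamics enters only for small \<open>p\<close>; further out
  \<open>half_period\<close> is merely an integral, and no orbit is claimed to exist. The main
  obstacle is \<open>g 0 < 0\<close>: then \<open>E\<close> grows only up to a maximum as
  \<open>P\<close> increases, and a critical argument might never be reached. But at this maximum
  \<open>P / E = crit_radius k\<close>, so the direction 0 is itself critical, and the minimum of
  the profile, being at most \<open>g 0\<close>, has become critical no later. Oddness of
  \<open>n\<close> and \<open>m\<close> enters three times: the reflection in the origin turns lower
  arcs into upper ones; equal profile values at 0 and pi give \<open>q = - p\<close>; and
  pi-periodicity makes a minimum at an end of \<open>{0..pi}\<close> two-sided. At a one-sided
  minimum with nonzero slope the singularity could be integrable. Degree 2, that is
  \<open>k = 0\<close>, has no critical value. Its field is linear and is treated by rescaling
  arcs.\<close>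

text \<open>
  The energy relation \<open>s + 2 g s ^ (k + 1) = E\<close> for \<open>s = r\<^sup>2\<close> becomes
  \<open>level_param k \<sigma> = g * E ^ k\<close> for \<open>\<sigma> = s / E\<close>. The derivative of \<open>level_param k\<close> vanishes at
  \<open>crit_radius k\<close>, and there \<open>d\<theta>/dt = (k + 1) / \<sigma> - k\<close> vanishes as well.
\<close>

definition level_param :: "nat \<Rightarrow> 'a::real_normed_field \<Rightarrow> 'a" where
  "level_param k s = (1 - s) / (2 * s ^ Suc k)"

definition crit_radius :: "nat \<Rightarrow> real" where
  "crit_radius k = (real k + 1) / real k"

definition crit_param :: "nat \<Rightarrow> real" where
  "crit_param k = level_param k (crit_radius k)"

text \<open>Between \<open>crit_param k\<close> and 0 the equation has two positive roots; the bound
  \<open>crit_radius k\<close> selects the smaller one, which continues the root 1 at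
  \<open>w = 0\<close>. For \<open>k = 0\<close> (where \<open>crit_radius k\<close> is 0) or
  \<open>w \<le> crit_param k\<close> there is no such root and the value is unspecified.\<close>

definition branch :: "nat \<Rightarrow> real \<Rightarrow> real" where
  "branch k w = (THE s. 0 < s \<and> s < crit_radius k \<and> level_param k s = w)"

text \<open>This is dt/d\<theta>, the reciprocal of the angular speed, as a function of the scaled
  argument \<open>w\<close>.\<close>

definition slowness :: "nat \<Rightarrow> real \<Rightarrow> real" where
  "slowness k w = 1 / ((real k + 1) / branch k w - real k)"

lemma crit_radius_gt_1: "k \<ge> 1 \<Longrightarrow> crit_radius k > 1"
  by (simp add: crit_radius_def field_simps)

lemma crit_param_neg: "k \<ge> 1 \<Longrightarrow> crit_param k < 0"
  using crit_radius_gt_1[of k] by (simp add: crit_param_def level_param_def divide_neg_pos)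

lemma level_param_deriv:
  fixes s :: "'a::real_normed_field"
  assumes "s \<noteq> 0"
  shows "(level_param k has_field_derivative
           - ((of_nat k + 1) - of_nat k * s) / (2 * s ^ (k + 2))) (at s)"
proof -
  have "((\<lambda>s. (1 - s) / (2 * s ^ Suc k)) has_field_derivative
      ((0 - 1) * (2 * s ^ Suc k) - (1 - s) * (2 * (of_nat (Suc k) * s ^ k))) / ((2 * s ^ Suc k) * (2 * s ^ Suc k))) (at s)"
    using assms DERIV_power[OF DERIV_ident, of "Suc k" s UNIV]
    by (intro DERIV_divide DERIV_diff DERIV_const DERIV_ident DERIV_cmult) auto
  also have "((0 - 1) * (2 * s ^ Suc k) - (1 - s) * (2 * (of_nat (Suc k) * s ^ k))) / ((2 * s ^ Suc k) * (2 * s ^ Suc k))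
     = - ((of_nat k + 1) - of_nat k * s) / (2 * s ^ (k + 2))"
    using assms by (simp add: divide_simps) (simp add: algebra_simps)
  finally show ?thesis unfolding level_param_def[abs_def] .
qed

text \<open>The sign of the derivative is tested only strictly between \<open>a\<close> and
  \<open>b\<close>. This admits \<open>b = crit_radius k\<close>, where the derivative vanishes, and
  so compares values with \<open>crit_param k\<close>.\<close>

lemma level_param_strict_decreasing:
  assumes "0 < a" "a < b" "b \<le> crit_radius k" "k \<ge> 1"
  shows "level_param k b < (level_param k a :: real)"
proof (rule DERIV_neg_imp_decreasing_open[OF assms(2)])
  fix x :: real assume x: "a < x" "x < b"
  have "real k * x < real k * b" using x assms by simp
  also have "\<dots> \<le> real k + 1" using assms by (simp add: crit_radius_def field_simps)
  finally have "real k * x < real k + 1" .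
  then have "- ((of_nat k + 1) - of_nat k * x) / (2 * x ^ (k + 2)) < 0"
    using x assms by (intro divide_neg_pos) auto
  moreover have "(level_param k has_field_derivative
     - ((of_nat k + 1) - of_nat k * x) / (2 * x ^ (k + 2))) (at x)"
    using x assms by (intro level_param_deriv) auto
  ultimately show "\<exists>y. (level_param k has_real_derivative y) (at x) \<and> y < 0" by blast
next
  show "continuous_on {a..b} (level_param k :: real \<Rightarrow> real)"
    using assms by (auto intro!: continuous_intros simp: level_param_def[abs_def])
qed

lemma branch_ex:
  assumes "k \<ge> 1" "w > crit_param k"
  shows "\<exists>!s. 0 < s \<and> s < crit_radius k \<and> level_param k s = w"
proof -
  \<comment> \<open>Chosen to make \<open>(1 - s0) / (2 * s0)\<close> equal to 1/2 + |w|. Since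
    \<open>s0\<close> is at most 1, the higher power in \<open>level_param\<close> only raises this
    value.\<close>
  define s0 where "s0 = 1 / (2 + 2 * \<bar>w\<bar>)"
  have s0: "0 < s0" "s0 \<le> 1" by (auto simp: s0_def field_simps)
  have "(1 - s0) / (2 * s0) = 1 / 2 + \<bar>w\<bar>"
    by (simp add: s0_def divide_simps) (simp add: algebra_simps)?
  then have "w \<le> (1 - s0) / (2 * s0)" by simp
  also have "\<dots> \<le> (1 - s0) / (2 * s0 ^ Suc k)"
    using s0 by (intro divide_left_mono mult_pos_pos) (auto simp: power_le_one mult_left_le)
  finally have w0: "w \<le> level_param k s0" by (simp add: level_param_def)
  have "\<exists>s\<ge>s0. s \<le> crit_radius k \<and> level_param k s = w"
    using s0 crit_radius_gt_1[OF assms(1)] assms w0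
    by (intro IVT2') (auto intro!: continuous_intros simp: crit_param_def level_param_def[abs_def])
  then obtain s where s: "s \<ge> s0" "s \<le> crit_radius k" "level_param k s = w" by blast
  have "s \<noteq> crit_radius k" using s assms by (auto simp: crit_param_def)
  then have "0 < s \<and> s < crit_radius k \<and> level_param k s = w" using s s0 by auto
  moreover have "s' = s''" if "0 < s' \<and> s' < crit_radius k \<and> level_param k s' = w"
     "0 < s'' \<and> s'' < crit_radius k \<and> level_param k s'' = w" for s' s''
    using level_param_strict_decreasing[of s' s'' k] level_param_strict_decreasing[of s'' s' k] that assms
    by (cases s' s'' rule: linorder_cases) auto
  ultimately show ?thesis by blast
qed

lemma branch:
  assumes "k \<ge> 1" "w > crit_param k"
  shows "0 < branch k w" "branch k w < crit_radius k" "level_param k (branch k w) = w"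
  using theI'[OF branch_ex[OF assms]] unfolding branch_def by auto

lemma branch_eqI:
  assumes "k \<ge> 1" "0 < s" "s < crit_radius k"
  shows "branch k (level_param k s) = s"
proof -
  have "level_param k s > crit_param k"
    using level_param_strict_decreasing[of s "crit_radius k" k] assms by (auto simp: crit_param_def)
  from the1_equality[OF branch_ex[OF assms(1) this]] show ?thesis
    using assms unfolding branch_def by auto
qed

lemma branch_antimono:
  assumes "k \<ge> 1" "crit_param k < a" "a \<le> b"
  shows "branch k b \<le> branch k a"
  using level_param_strict_decreasing[of "branch k a" "branch k b" k] branch[of k a] branch[of k b] assms
  by fastforce

lemma slowness_denominator_pos:
  assumes "k \<ge> 1" "0 < s" "s < crit_radius k"
  shows "(real k + 1) / s - real k > 0"
  using assms by (simp add: crit_radius_def field_simps)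

lemma slowness_pos:
  assumes "k \<ge> 1" "w > crit_param k"
  shows "slowness k w > 0"
  using slowness_denominator_pos[of k "branch k w"] branch[OF assms] assms
  by (simp add: slowness_def)

lemma slowness_0: "k \<ge> 1 \<Longrightarrow> slowness k 0 = 1"
  using branch_eqI[of k 1] crit_radius_gt_1[of k] by (simp add: slowness_def level_param_def)

lemma slowness_less_1:
  assumes "k \<ge> 1" "w > 0"
  shows "slowness k w < 1"
proof -
  have w: "w > crit_param k" using assms crit_param_neg[of k] by simp
  note b = branch[OF assms(1) w]
  have "branch k w < 1"
    using b assms unfolding level_param_def
    by (metis (no_types, opaque_lifting) diff_gt_0_iff_gt mult_pos_pos zero_less_divide_iff zero_less_numeral zero_less_power not_less_iff_gr_or_eq)
  then have "(real k + 1) / branch k w > real k + 1"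
    using b by (simp add: less_divide_eq)
  then show ?thesis by (simp add: slowness_def)
qed

section \<open>Holomorphic extension of the time density\<close>

lemma convex_segment_thickening:
  fixes a b :: real
  shows "convex (\<Union>x\<in>of_real ` {a..b}. ball (x::complex) e)"
proof -
  have ball: "ball x e = (\<Union>y\<in>ball 0 e. {x + y})" for x :: complex
  proof (intro set_eqI iffI)
    fix z assume "z \<in> ball x e"
    then have "z - x \<in> ball 0 e" by (simp add: dist_norm norm_minus_commute)
    then show "z \<in> (\<Union>y\<in>ball 0 e. {x + y})" by (intro UN_I[of "z - x"]) auto
  qed (auto simp: dist_norm)
  have "convex (of_real ` {a..b} :: complex set)"
    by (rule convex_linear_image[OF bounded_linear.linear[OF bounded_linear_of_real] convex_real_interval(5)])
  from convex_sums[OF this convex_ball[of 0 e]] show ?thesis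
    by (subst ball)
qed

text \<open>The Noshiro-Warschawski criterion. Along the segment from \<open>z\<close> to
  \<open>z'\<close>, the real part of \<open>f\<close> times the conjugate of \<open>z' - z\<close>
  has derivative \<open>Re f' * (cmod (z' - z))\<^sup>2 < 0\<close>, so the values at the ends
  differ.\<close>

lemma inj_on_Re_deriv_neg:
  assumes "convex V" and d: "\<And>z. z \<in> V \<Longrightarrow> (f has_field_derivative f' z) (at z)"
    and neg: "\<And>z. z \<in> V \<Longrightarrow> Re (f' z) < 0"
  shows "inj_on f V"
proof (rule inj_onI, rule ccontr)
  fix z z' assume z: "z \<in> V" "z' \<in> V" "f z = f z'" "z \<noteq> z'"
  define h where "h = (\<lambda>t. Re (f (z + of_real t * (z' - z)) * cnj (z' - z)))"
  have "h 1 < h 0"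
  proof (rule DERIV_neg_imp_decreasing[where f = h and a = 0 and b = 1])
    show "(0::real) < 1" by simp
  next
    fix t :: real assume t: "0 \<le> t" "t \<le> 1"
    let ?u = "z + of_real t * (z' - z)"
    have u: "?u \<in> V"
      using convexD_alt[OF assms(1) z(1,2) t] by (simp add: algebra_simps scaleR_conv_of_real)
    have "((\<lambda>t. f (z + of_real t * (z' - z)) * cnj (z' - z)) has_vector_derivative
             f' ?u * (z' - z) * cnj (z' - z)) (at t)"
    proof -
      have 1: "((\<lambda>t. z + of_real t * (z' - z)) has_vector_derivative (z' - z)) (at t)"
      proof -
        have "((\<lambda>t. z + of_real t * (z' - z)) has_vector_derivative (0 + of_real 1 * (z' - z))) (at t)"
          by (intro derivative_intros has_vector_derivative_of_real DERIV_ident)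
        then show ?thesis by simp
      qed
      have 2: "((\<lambda>t. f (z + of_real t * (z' - z))) has_vector_derivative (z' - z) * f' ?u) (at t)"
        using field_vector_diff_chain_at[OF 1 d[OF u]] by (simp add: o_def)
      show ?thesis using has_vector_derivative_mult_left[OF 2, of "cnj (z' - z)"]
        by (simp add: mult_ac)
    qed
    then have "(h has_real_derivative Re (f' ?u * (z' - z) * cnj (z' - z))) (at t)"
      unfolding h_def has_real_derivative_iff_has_vector_derivative
      by (rule bounded_linear.has_vector_derivative[OF bounded_linear_Re])
    also have "Re (f' ?u * (z' - z) * cnj (z' - z)) = Re (f' ?u) * (cmod (z' - z))\<^sup>2"
    proof -
      have "Re (a * w * cnj w) = Re a * (cmod w)\<^sup>2" for a w
        unfolding cmod_power2 by (simp add: algebra_simps power2_eq_square)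
      then show ?thesis by blast
    qed
    finally have "(h has_real_derivative Re (f' ?u) * (cmod (z' - z))\<^sup>2) (at t)" .
    moreover have "Re (f' ?u) * (cmod (z' - z))\<^sup>2 < 0"
      using neg[OF u] z(4) by (intro mult_neg_pos) auto
    ultimately show "\<exists>y. (h has_real_derivative y) (at t) \<and> y < 0" by blast
  qed
  moreover have "h 1 = h 0" using z by (simp add: h_def)
  ultimately show False by simp
qed

text \<open>The derivative of \<open>level_param k\<close> is negative at the branch values of
  \<open>{a..b}\<close>. By compactness its real part stays negative on a convex complex
  neighbourhood of them, where \<open>level_param k\<close> is therefore injective. Its holomorphic
  inverse extends \<open>branch k\<close>.\<close>

lemma slowness_holomorphic_extension:
  assumes k: "k \<ge> 1" and ab: "crit_param k < a" "a \<le> b"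
  obtains \<Omega> S where "open \<Omega>" "of_real ` {a..b} \<subseteq> \<Omega>" "S holomorphic_on \<Omega>"
    "\<And>w. w \<in> {a..b} \<Longrightarrow> S (of_real w) = of_real (slowness k w)"
proof -
  define D where "D = (\<lambda>z::complex. - ((of_nat k + 1) - of_nat k * z) / (2 * z ^ (k + 2)))"
  \<comment> \<open>Membership excludes the pole of \<open>level_param\<close>, provides the sign
    condition for injectivity, and excludes the zero of the denominator of
    \<open>slowness\<close>.\<close>
  define U where "U = ((-{0}) \<inter> (\<lambda>z. Re (D z)) -` {..<0}) \<inter> {z. of_nat k * z \<noteq> of_nat k + 1}"
  define sa sb where "sa = branch k a" and "sb = branch k b"
  have ba: "0 < sa" "sa < crit_radius k" "level_param k sa = a"
    unfolding sa_def by (rule branch[OF k ab(1)])+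
  have bb: "0 < sb" "sb < crit_radius k" "level_param k sb = b"
    unfolding sb_def by (rule branch[OF k less_le_trans[OF ab]])+
  have sba: "sb \<le> sa" unfolding sa_def sb_def by (rule branch_antimono[OF k ab])
  have "open ((-{0}) \<inter> (\<lambda>z. Re (D z)) -` {..<0})"
    unfolding D_def by (intro continuous_open_preimage continuous_intros) auto
  moreover have "open {z::complex. of_nat k * z \<noteq> of_nat k + 1}"
    by (intro open_Collect_neq continuous_intros)
  ultimately have "open U" unfolding U_def by (rule open_Int)
  moreover have "of_real ` {sb..sa} \<subseteq> U"
  proof clarify
    fix s assume s: "s \<in> {sb..sa}"
    then have s': "0 < s" "s < crit_radius k" using bb ba by auto
    then have s': "0 < s" "real k * s < real k + 1"
      using k by (auto simp: crit_radius_def field_simps)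
    have "D (of_real s) = of_real (- ((real k + 1) - real k * s) / (2 * s ^ (k + 2)))"
      by (simp add: D_def)
    moreover have "- ((real k + 1) - real k * s) / (2 * s ^ (k + 2)) < 0"
      using s' by (intro divide_neg_pos) auto
    moreover have "of_nat k * complex_of_real s \<noteq> of_nat k + 1"
    proof
      assume "of_nat k * complex_of_real s = of_nat k + 1"
      then have "complex_of_real (real k * s) = of_real (real k + 1)" by simp
      then show False using s' by (simp only: of_real_eq_iff)
    qed
    ultimately show "complex_of_real s \<in> U" using s' by (simp add: U_def)
  qed
  ultimately obtain V where V: "open V" "convex V" "of_real ` {sb..sa} \<subseteq> V" "V \<subseteq> U"
  proof -
    assume open_U: "open U" and sub: "of_real ` {sb..sa} \<subseteq> U"
    have "compact (of_real ` {sb..sa} :: complex set)"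
      by (intro compact_continuous_image continuous_intros compact_Icc)
    from compact_subset_open_imp_ball_epsilon_subset[OF this open_U sub]
    obtain e where e: "e > 0" "(\<Union>x\<in>of_real ` {sb..sa}. ball x e) \<subseteq> U" by auto
    show thesis
    proof (rule that[OF _ convex_segment_thickening _ e(2)])
      show "open (\<Union>x\<in>of_real ` {sb..sa}. ball (x::complex) e)"
        by (intro open_UN ballI open_ball)
      show "of_real ` {sb..sa} \<subseteq> (\<Union>x\<in>of_real ` {sb..sa}. ball (x::complex) e)"
      proof
        fix z :: complex assume "z \<in> of_real ` {sb..sa}"
        then show "z \<in> (\<Union>x\<in>of_real ` {sb..sa}. ball (x::complex) e)"
          by (rule UN_I) (simp add: e(1))
      qed
    qed
  qed
  have der: "(level_param k has_field_derivative D z) (at z)" if "z \<in> V" for z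
  proof -
    have "z \<in> U" using that V(4) by blast
    then have "z \<noteq> 0" by (simp add: U_def)
    then show ?thesis unfolding D_def by (rule level_param_deriv)
  qed
  have inj: "inj_on (level_param k) V"
  proof (rule inj_on_Re_deriv_neg[OF V(2) der])
    fix z assume "z \<in> V"
    then have "z \<in> U" using V(4) by blast
    then show "Re (D z) < 0" by (simp add: U_def)
  qed
  have hol: "level_param k holomorphic_on V"
    unfolding holomorphic_on_def field_differentiable_def
    using has_field_derivative_at_within[OF der] by blast
  obtain g where g: "g holomorphic_on (level_param k ` V)" "\<And>z. z \<in> V \<Longrightarrow> g (level_param k z) = z"
    using holomorphic_has_inverse[OF hol V(1) inj] by metis
  show thesis
  proof (rule that[of "level_param k ` V" "\<lambda>z. 1 / ((of_nat k + 1) / g z - of_nat k)"])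
    show "open (level_param k ` V)" by (rule open_mapping_thm3[OF hol V(1) inj])
    have real: "level_param k (complex_of_real (branch k w)) = of_real w \<and> of_real (branch k w) \<in> V"
      if w: "w \<in> {a..b}" for w
    proof -
      have "sb \<le> branch k w" "branch k w \<le> sa"
        using branch_antimono[OF k, of a w] branch_antimono[OF k, of w b] w ab by (auto simp: sa_def sb_def)
      moreover have "level_param k (complex_of_real (branch k w)) = of_real (level_param k (branch k w))"
        by (simp add: level_param_def)
      ultimately show ?thesis using V(3) branch(3)[OF k, of w] ab w by auto
    qed
    show "of_real ` {a..b} \<subseteq> level_param k ` V"
    proof
      fix z :: complex assume "z \<in> of_real ` {a..b}"
      then obtain w where w: "w \<in> {a..b}" "z = of_real w" by auto
      show "z \<in> level_param k ` V"
        by (rule image_eqI[of _ _ "of_real (branch k w)"]) (use real[OF w(1)] w(2) in auto)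
    qed
    show "1 / ((of_nat k + 1) / g (of_real w) - of_nat k) = complex_of_real (slowness k w)"
      if w: "w \<in> {a..b}" for w
      using g(2)[of "of_real (branch k w)"] real[OF w] by (simp add: slowness_def)
    show "(\<lambda>z. 1 / ((of_nat k + 1) / g z - of_nat k)) holomorphic_on level_param k ` V"
    proof (intro holomorphic_intros g(1))
      fix z assume "z \<in> level_param k ` V"
      then obtain s where s: "s \<in> V" "z = level_param k s" by auto
      have "s \<in> U" using s(1) V(4) by blast
      then have s': "s \<noteq> 0" "of_nat k * s \<noteq> of_nat k + 1" by (simp_all add: U_def)
      have gz: "g z = s" using g(2)[OF s(1)] s(2) by simp
      then show "g z \<noteq> 0" using s' by simp
      show "(of_nat k + 1) / g z - of_nat k \<noteq> 0"
      proof
        assume "(of_nat k + 1) / g z - of_nat k = 0"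
        then have "(of_nat k + 1) / s = of_nat k" unfolding gz by (rule eq_iff_diff_eq_0[THEN iffD2])
        then have "of_nat k + 1 = of_nat k * s" by (simp only: nonzero_divide_eq_eq[OF s'(1)])
        then show False using s'(2) by (rule notE[OF _ sym, rotated])
      qed
    qed
  qed
qed

lemma slowness_continuous:
  assumes k: "k \<ge> 1"
  shows "continuous_on {crit_param k<..} (slowness k)"
proof -
  have "isCont (slowness k) w" if w: "w > crit_param k" for w
  proof -
    define a b where "a = (crit_param k + w) / 2" and "b = w + 1"
    have ab: "crit_param k < a" "a \<le> b" "a < w" "w < b" using w by (auto simp: a_def b_def)
    from slowness_holomorphic_extension[OF k ab(1,2)] obtain \<Omega> S where
      S: "open \<Omega>" "of_real ` {a..b} \<subseteq> \<Omega>" "S holomorphic_on \<Omega>"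
      "\<And>w. w \<in> {a..b} \<Longrightarrow> S (of_real w) = of_real (slowness k w)" by metis
    have "continuous_on {a..b} (\<lambda>w. Re (S (of_real w)))"
      by (intro continuous_intros continuous_on_compose2[OF holomorphic_on_imp_continuous_on[OF S(3)]])
         (use S(2) in auto)
    then have "continuous_on {a..b} (slowness k)"
      by (rule continuous_on_eq) (use S(4) in auto)
    then show ?thesis
      by (rule continuous_on_interior) (use ab in auto)
  qed
  then show ?thesis by (simp add: continuous_at_imp_continuous_on)
qed

text \<open>\<open>level_param k\<close> has its minimum at \<open>crit_radius k\<close> and exceeds
  it at least quadratically to the left. Hence \<open>branch k w\<close> is within a multiple of the
  square root of \<open>w - crit_param k\<close> from \<open>crit_radius k\<close>, and the
  denominator of \<open>slowness\<close> is at most proportional to that distance as long as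
  \<open>w \<le> B\<close> keeps the branch away from 0.\<close>

lemma slowness_lower_bound:
  assumes k: "k \<ge> 1"
  shows "\<exists>c>0. \<forall>w. crit_param k < w \<and> w \<le> B \<longrightarrow> slowness k w \<ge> c / sqrt (w - crit_param k)"
proof -
  define \<sigma> where "\<sigma> = crit_radius k"
  have \<sigma>: "\<sigma> > 1" using crit_radius_gt_1[OF k] by (simp add: \<sigma>_def)
  \<comment> \<open>The value for which \<open>2 * c - real k / (2 * x ^ (k + 2))\<close> vanishes
    at \<open>x = \<sigma>\<close>; it is then nonpositive for smaller positive
    \<open>x\<close>.\<close>
  define c where "c = real k / (4 * \<sigma> ^ (k + 2))"
  have c: "c > 0" using k \<sigma> by (simp add: c_def)
  have kk: "real k * \<sigma> = real k + 1" using k by (simp add: \<sigma>_def crit_radius_def)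
  have quad: "level_param k s - crit_param k \<ge> c * (\<sigma> - s)\<^sup>2" if s: "0 < s" "s < \<sigma>" for s
  proof -
    have "level_param k s - c * (\<sigma> - s)\<^sup>2 \<ge> level_param k \<sigma> - c * (\<sigma> - \<sigma>)\<^sup>2"
    proof (rule DERIV_nonpos_imp_nonincreasing[of s \<sigma>])
      show "s \<le> \<sigma>" using s by simp
    next
      fix x assume x: "s \<le> x" "x \<le> \<sigma>"
      have d: "((\<lambda>s. level_param k s - c * (\<sigma> - s)\<^sup>2) has_real_derivative
         - ((real k + 1) - real k * x) / (2 * x ^ (k + 2)) - c * (2 * (\<sigma> - x) * (0 - 1))) (at x)"
        using x s by (auto intro!: derivative_eq_intros level_param_deriv)
      have "- ((real k + 1) - real k * x) / (2 * x ^ (k + 2)) - c * (2 * (\<sigma> - x) * (0 - 1))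
         = (\<sigma> - x) * (2 * c - real k / (2 * x ^ (k + 2)))"
        unfolding kk[symmetric] using x s by (simp add: divide_simps) (simp add: algebra_simps)
      also have "\<dots> \<le> 0"
      proof (rule mult_nonneg_nonpos)
        have "real k / (2 * \<sigma> ^ (k + 2)) \<le> real k / (2 * x ^ (k + 2))"
          using x s by (intro divide_left_mono mult_left_mono power_mono mult_pos_pos) auto
        then show "2 * c - real k / (2 * x ^ (k + 2)) \<le> 0" by (simp add: c_def)
      qed (use x in auto)
      finally show "\<exists>y. ((\<lambda>s. level_param k s - c * (\<sigma> - s)\<^sup>2) has_real_derivative y) (at x) \<and> y \<le> 0"
        using d by blast
    qed
    then show ?thesis by (simp add: crit_param_def \<sigma>_def)
  qed
  \<comment> \<open>An upper bound of \<open>1 / s\<close>: the equation for \<open>s\<close> reads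
    \<open>1 / s = 1 + 2 * w * s ^ k\<close>, and only \<open>s < 1\<close> needs it.\<close>
  define M where "M = 1 + 2 * \<bar>B\<bar>"
  have M: "M \<ge> 1" by (simp add: M_def)
  show ?thesis
  proof (intro exI[of _ "sqrt c / (real k * M)"] conjI allI impI)
    show "sqrt c / (real k * M) > 0" using c k M by simp
    fix w assume w: "crit_param k < w \<and> w \<le> B"
    define s where "s = branch k w"
    have s: "0 < s" "s < \<sigma>" "level_param k s = w"
      using branch[OF k, of w] w by (auto simp: s_def \<sigma>_def)
    have inv: "1 / s \<le> M"
    proof (cases "s < 1")
      case True
      have "1 / s = 1 + 2 * w * s ^ k"
        using s by (simp add: level_param_def field_simps)
      also have "\<dots> \<le> 1 + 2 * \<bar>B\<bar> * 1"
      proof -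
        have "w * s ^ k \<le> \<bar>B\<bar> * s ^ k"
          using s w by (intro mult_right_mono) auto
        also have "\<dots> \<le> \<bar>B\<bar> * 1"
          using s True by (intro mult_left_mono) (auto simp: power_le_one)
        finally show ?thesis by simp
      qed
      finally show ?thesis by (simp add: M_def)
    next
      case False
      then have "1 / s \<le> 1" by simp
      then show ?thesis using M by simp
    qed
    have "sqrt c * (\<sigma> - s) = sqrt (c * (\<sigma> - s)\<^sup>2)"
      using s by (simp add: real_sqrt_mult)
    also have "\<dots> \<le> sqrt (w - crit_param k)" using quad[OF s(1,2)] s(3) by simp
    finally have sq: "sqrt c * (\<sigma> - s) \<le> sqrt (w - crit_param k)" .
    have "(real k + 1) / s - real k = real k * (\<sigma> - s) * (1 / s)"
      unfolding kk[symmetric] using s by (simp add: field_simps)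
    also have "\<dots> \<le> real k * (\<sigma> - s) * M"
      using inv s by (intro mult_left_mono) auto
    also have "\<dots> \<le> real k * M * (sqrt (w - crit_param k) / sqrt c)"
    proof -
      have "\<sigma> - s \<le> sqrt (w - crit_param k) / sqrt c" using sq c by (simp add: field_simps)
      then have "(real k * M) * (\<sigma> - s) \<le> (real k * M) * (sqrt (w - crit_param k) / sqrt c)"
        using M by (intro mult_left_mono) auto
      then show ?thesis by (simp add: mult_ac)
    qed
    finally have le: "(real k + 1) / s - real k \<le> real k * M * (sqrt (w - crit_param k) / sqrt c)" .
    have "(real k + 1) / s - real k > 0"
      using slowness_denominator_pos[OF k, of s] s by (simp add: \<sigma>_def)
    with le have pos: "0 < ((real k + 1) / s - real k) * (real k * M * (sqrt (w - crit_param k) / sqrt c))"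
      by (meson less_le_trans mult_pos_pos)
    have "sqrt c / (real k * M) / sqrt (w - crit_param k) = 1 / (real k * M * (sqrt (w - crit_param k) / sqrt c))"
      by simp
    also have "\<dots> \<le> 1 / ((real k + 1) / s - real k)"
      by (rule divide_left_mono[OF le zero_le_one]) (use pos in \<open>simp only: mult.commute\<close>)
    finally show "sqrt c / (real k * M) / sqrt (w - crit_param k) \<le> slowness k w"
      by (simp only: slowness_def s_def)
  qed
qed

section \<open>Analyticity of the half period\<close>

text \<open>The variable \<open>P\<close> is \<open>p\<^sup>2\<close> for the orbit through \<open>(p, 0)\<close>, and \<open>a = g 0\<close>.\<close>

definition energy_power :: "nat \<Rightarrow> real \<Rightarrow> 'a::real_normed_field \<Rightarrow> 'a" where
  "energy_power k a P = (P + 2 * of_real a * P ^ Suc k) ^ k"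

definition half_period :: "nat \<Rightarrow> (real \<Rightarrow> real) \<Rightarrow> real \<Rightarrow> real" where
  "half_period k g P = integral {0..pi} (\<lambda>\<theta>. slowness k (g \<theta> * energy_power k (g 0) P))"

text \<open>The condition covers all of \<open>{0..P}\<close> because analytic continuation runs
  along this segment.\<close>

definition regular_up_to :: "nat \<Rightarrow> (real \<Rightarrow> real) \<Rightarrow> real \<Rightarrow> bool" where
  "regular_up_to k g P \<longleftrightarrow> (\<forall>Q\<in>{0..P}. \<forall>\<theta>\<in>{0..pi}. crit_param k < g \<theta> * energy_power k (g 0) Q)"

lemma energy_power_0 [simp]: "k \<ge> 1 \<Longrightarrow> energy_power k a 0 = 0"
  by (simp add: energy_power_def)

lemma energy_power_of_real: "energy_power k a (of_real P) = of_real (energy_power k a P)"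
  by (simp add: energy_power_def)

lemma continuous_on_energy_power [continuous_intros]:
  "continuous_on A f \<Longrightarrow> continuous_on A (\<lambda>x. energy_power k a (f x))"
  unfolding energy_power_def by (intro continuous_intros)

lemma holomorphic_energy_power: "energy_power k a holomorphic_on A"
  unfolding energy_power_def[abs_def] by (intro holomorphic_intros)

lemma half_period_integrand_continuous:
  assumes "k \<ge> 1" "continuous_on UNIV g" "regular_up_to k g P" "Q \<in> {0..P}"
  shows "continuous_on {0..pi} (\<lambda>\<theta>. slowness k (g \<theta> * energy_power k (g 0) Q))"
  by (rule continuous_on_compose2[OF slowness_continuous[OF assms(1)]])
     (use assms in \<open>auto intro!: continuous_intros continuous_on_subset[OF assms(2)] simp: regular_up_to_def\<close>)

text \<open>Over the compact rectangle the arguments fill part of a compact interval above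
  \<open>crit_param k\<close>, on which \<open>slowness\<close> extends. A compactness argument
  yields one radius \<rho>, uniform in the angle, for which complex \<open>P\<close> keep the
  argument in the domain of the extension; then one differentiates under the integral.\<close>

lemma half_period_holomorphic_extension:
  assumes k: "k \<ge> 1" and g: "continuous_on UNIV g" and P: "P \<ge> 0" and reg: "regular_up_to k g P"
  obtains \<rho> \<Phi> where "\<rho> > 0" "\<Phi> holomorphic_on (\<Union>x\<in>of_real ` {0..P}. ball x \<rho>)"
    "\<And>Q. Q \<in> {0..P} \<Longrightarrow> \<Phi> (of_real Q) = of_real (half_period k g Q)"
proof -
  define h where "h = (\<lambda>(z, \<theta>). of_real (g \<theta>) * energy_power k (g 0) z :: complex)"
  define w where "w = (\<lambda>(Q, \<theta>). g \<theta> * energy_power k (g 0) Q :: real)"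
  have gc: "continuous_on A (\<lambda>x. g (f x))" if "continuous_on A f" for A :: "'a::topological_space set" and f
    by (rule continuous_on_compose2[OF g that]) simp
  have w_cont: "continuous_on ({0..P} \<times> {0..pi}) w"
    unfolding w_def case_prod_unfold by (intro continuous_intros gc)
  have comp: "compact ({0..P} \<times> {0..pi::real})" by (intro compact_Times compact_Icc)
  have ne: "{0..P} \<times> {0..pi} \<noteq> {}" using P by auto
  from continuous_attains_inf[OF comp ne w_cont] obtain u1 where
    u1: "u1 \<in> {0..P} \<times> {0..pi}" "\<And>u. u \<in> {0..P} \<times> {0..pi} \<Longrightarrow> w u1 \<le> w u" by blast
  from continuous_attains_sup[OF comp ne w_cont] obtain u2 where
    u2: "u2 \<in> {0..P} \<times> {0..pi}" "\<And>u. u \<in> {0..P} \<times> {0..pi} \<Longrightarrow> w u \<le> w u2" by blast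
  have "crit_param k < w u1" using u1(1) reg by (auto simp: regular_up_to_def w_def)
  from slowness_holomorphic_extension[OF k this u1(2)[OF u2(1)]] obtain \<Omega> S where
    S: "open \<Omega>" "of_real ` {w u1..w u2} \<subseteq> \<Omega>" "S holomorphic_on \<Omega>"
      "\<And>x. x \<in> {w u1..w u2} \<Longrightarrow> S (of_real x) = of_real (slowness k x)" by metis
  have h_cont: "continuous_on A h" for A
    unfolding h_def case_prod_unfold by (intro continuous_intros gc)
  have "open (h -` \<Omega>)" by (rule open_vimage[OF S(1) h_cont])
  moreover have "compact (of_real ` {0..P} \<times> {0..pi} :: (complex \<times> real) set)"
    by (intro compact_Times compact_Icc compact_continuous_image continuous_intros)
  moreover have hw: "h (of_real Q, \<theta>) = of_real (w (Q, \<theta>))" for Q \<theta>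
    by (simp add: h_def w_def energy_power_of_real)
  have wI: "w (Q, \<theta>) \<in> {w u1..w u2}" if "Q \<in> {0..P}" "\<theta> \<in> {0..pi}" for Q \<theta>
    using u1(2)[of "(Q, \<theta>)"] u2(2)[of "(Q, \<theta>)"] that by auto
  have "of_real ` {0..P} \<times> {0..pi} \<subseteq> h -` \<Omega>"
  proof clarify
    fix Q \<theta> assume "Q \<in> {0..P}" "\<theta> \<in> {0..pi}"
    from wI[OF this] show "(complex_of_real Q, \<theta>) \<in> h -` \<Omega>"
      using S(2) by (auto simp: hw)
  qed
  ultimately obtain \<rho> where \<rho>: "\<rho> > 0" "(\<Union>x\<in>of_real ` {0..P} \<times> {0..pi}. ball x \<rho>) \<subseteq> h -` \<Omega>"
    using compact_subset_open_imp_ball_epsilon_subset by metis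
  define N where "N = (\<Union>x\<in>of_real ` {0..P}. ball (x::complex) \<rho>)"
  have N_open: "open N" unfolding N_def by (intro open_UN ballI open_ball)
  have hN: "h (z, \<theta>) \<in> \<Omega>" if "z \<in> N" "\<theta> \<in> {0..pi}" for z \<theta>
  proof -
    from that obtain x where x: "x \<in> of_real ` {0..P}" "z \<in> ball x \<rho>" unfolding N_def by blast
    have "(z, \<theta>) \<in> ball (x, \<theta>) \<rho>" using x(2) by (simp add: dist_Pair_Pair)
    then show ?thesis using \<rho>(2) x(1) that(2) by blast
  qed
  define f where "f = (\<lambda>z \<theta>. S (h (z, \<theta>)))"
  define fx where "fx = (\<lambda>z \<theta>. deriv S (h (z, \<theta>)) * (of_real (g \<theta>) * deriv (energy_power k (g 0)) z))"
  have hol: "(\<lambda>z. integral (cbox 0 pi) (f z)) holomorphic_on N"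
  proof (rule leibniz_rule_holomorphic[where fx = fx])
    fix z \<theta> assume z: "z \<in> N" "\<theta> \<in> cbox 0 pi"
    then have h\<Omega>: "h (z, \<theta>) \<in> \<Omega>" using hN by simp
    have "((\<lambda>z. h (z, \<theta>)) has_field_derivative of_real (g \<theta>) * deriv (energy_power k (g 0)) z) (at z)"
      unfolding h_def case_prod_conv
      by (intro DERIV_cmult holomorphic_derivI[OF holomorphic_energy_power[of k "g 0" UNIV]]) auto
    with holomorphic_derivI[OF S(3,1) h\<Omega>, where T = UNIV]
    have "((\<lambda>z. S (h (z, \<theta>))) has_field_derivative fx z \<theta>) (at z)"
      unfolding fx_def by (rule DERIV_chain2[where f = S and g = "\<lambda>z. h (z, \<theta>)"])
    then show "((\<lambda>z. f z \<theta>) has_field_derivative fx z \<theta>) (at z within N)"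
      unfolding f_def by (rule has_field_derivative_at_within)
  next
    fix z assume "z \<in> N"
    then show "f z integrable_on cbox 0 pi"
      unfolding f_def
      by (intro integrable_continuous continuous_on_compose2[OF holomorphic_on_imp_continuous_on[OF S(3)]]
            continuous_on_compose2[OF h_cont[of UNIV]] continuous_intros) (use hN in auto)
  next
    show "continuous_on (N \<times> cbox 0 pi) (\<lambda>(z, \<theta>). fx z \<theta>)"
      unfolding fx_def case_prod_unfold
      by (intro continuous_intros gc
            continuous_on_compose2[OF holomorphic_on_imp_continuous_on[OF holomorphic_deriv[OF S(3,1)]]]
            continuous_on_compose2[OF holomorphic_on_imp_continuous_on[OF holomorphic_deriv[OF holomorphic_energy_power[of k "g 0" UNIV] open_UNIV]]]
            continuous_on_compose2[OF h_cont[of UNIV]]) (use hN in auto)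
  next
    show "convex N" unfolding N_def by (rule convex_segment_thickening)
  qed
  show thesis
  proof (rule that[OF \<rho>(1) hol[unfolded N_def]])
    fix Q assume Q: "Q \<in> {0..P}"
    have "integral (cbox 0 pi) (f (of_real Q)) =
      integral {0..pi} (\<lambda>\<theta>. complex_of_real (slowness k (g \<theta> * energy_power k (g 0) Q)))"
    proof -
      have "f (of_real Q) \<theta> = of_real (slowness k (g \<theta> * energy_power k (g 0) Q))" if "\<theta> \<in> {0..pi}" for \<theta>
        unfolding f_def hw using S(4)[OF wI[OF Q that]] by (simp add: w_def)
      then show ?thesis unfolding cbox_interval by (rule integral_cong)
    qed
    also have "\<dots> = of_real (half_period k g Q)"
      unfolding half_period_def
      by (intro integral_unique has_integral_of_real integrable_integral integrable_continuous_real half_period_integrand_continuous[OF k g reg Q])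
    finally show "integral (cbox 0 pi) (f (of_real Q)) = of_real (half_period k g Q)" .
  qed
qed

text \<open>Identity theorem on a thickened segment. The set where the sum is known to be constant
  is a real interval with limit point 0, which lies in the domain because the extensions include
  \<open>P = 0\<close>.\<close>

lemma half_period_sum_continuation:
  assumes k: "k \<ge> 1" "l \<ge> 1" and gb: "continuous_on UNIV g" "continuous_on UNIV b"
    and reg: "regular_up_to k g P" "regular_up_to l b P" and \<delta>: "\<delta> > 0" and P: "P > 0"
    and eq: "\<And>Q. 0 < Q \<Longrightarrow> Q < \<delta> \<Longrightarrow> half_period k g Q + half_period l b Q = C"
    and Q: "Q \<in> {0..P}"
  shows "half_period k g Q + half_period l b Q = C"
proof -
  have P0: "P \<ge> 0" using P by simp
  from half_period_holomorphic_extension[OF k(1) gb(1) P0 reg(1)] obtain r1 F1 where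
    F1: "r1 > 0" "F1 holomorphic_on (\<Union>x\<in>of_real ` {0..P}. ball x r1)"
    "\<And>Q. Q \<in> {0..P} \<Longrightarrow> F1 (of_real Q) = of_real (half_period k g Q)" by metis
  from half_period_holomorphic_extension[OF k(2) gb(2) P0 reg(2)] obtain r2 F2 where
    F2: "r2 > 0" "F2 holomorphic_on (\<Union>x\<in>of_real ` {0..P}. ball x r2)"
    "\<And>Q. Q \<in> {0..P} \<Longrightarrow> F2 (of_real Q) = of_real (half_period l b Q)" by metis
  define r where "r = min r1 r2"
  define N where "N = (\<Union>x\<in>of_real ` {0..P}. ball (x::complex) r)"
  have N: "open N" "convex N" unfolding N_def by (intro open_UN ballI open_ball, rule convex_segment_thickening)
  have segN: "of_real Q \<in> N" if "Q \<in> {0..P}" for Q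
    unfolding N_def using that F1(1) F2(1) by (intro UN_I[of "of_real Q"]) (auto simp: r_def)
  define \<epsilon> where "\<epsilon> = min \<delta> P"
  define U where "U = complex_of_real ` {0<..<\<epsilon>}"
  have "(F1 (of_real Q) + F2 (of_real Q)) - of_real C = 0"
  proof (rule analytic_continuation[where f = "\<lambda>z. F1 z + F2 z - of_real C"])
    show "(\<lambda>z. F1 z + F2 z - of_real C) holomorphic_on N"
      by (intro holomorphic_intros holomorphic_on_subset[OF F1(2)] holomorphic_on_subset[OF F2(2)])
         (auto simp: N_def r_def)
    show "open N" "connected N" using N by (auto intro: convex_connected)
    show "U \<subseteq> N" using segN by (auto simp: U_def \<epsilon>_def)
    show "0 \<in> N" using segN[of 0] P by simp
    show "0 islimpt U"
      unfolding islimpt_approachable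
    proof (intro allI impI)
      fix e :: real assume "e > 0"
      define t where "t = min (\<epsilon> / 2) (e / 2)"
      have "t > 0" "t < \<epsilon>" "t < e" using \<open>e > 0\<close> \<delta> P by (auto simp: t_def \<epsilon>_def)
      then show "\<exists>x'\<in>U. x' \<noteq> 0 \<and> dist x' 0 < e"
        by (intro bexI[of _ "of_real t"]) (auto simp: U_def)
    qed
    show "F1 z + F2 z - of_real C = 0" if "z \<in> U" for z
    proof -
      from that obtain t where t: "z = of_real t" "0 < t" "t < \<epsilon>" by (auto simp: U_def)
      then have "F1 z + F2 z = of_real (half_period k g t + half_period l b t)"
        using F1(3)[of t] F2(3)[of t] by (simp add: \<epsilon>_def)
      moreover have "half_period k g t + half_period l b t = C" using t by (intro eq) (auto simp: \<epsilon>_def)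
      ultimately show ?thesis by simp
    qed
    show "complex_of_real Q \<in> N" using segN Q .
  qed
  then have "complex_of_real (half_period k g Q + half_period l b Q) = of_real C"
    using F1(3)[OF Q] F2(3)[OF Q] by simp
  then show ?thesis by (simp only: of_real_eq_iff)
qed

section \<open>Blow-up of the half period\<close>

definition twice_cont_diff :: "(real \<Rightarrow> real) \<Rightarrow> bool" where
  "twice_cont_diff g \<longleftrightarrow> (\<exists>g' g''. (\<forall>x. (g has_real_derivative g' x) (at x)) \<and>
     (\<forall>x. (g' has_real_derivative g'' x) (at x)) \<and> continuous_on UNIV g'')"

lemma twice_cont_diffI:
  assumes "\<And>x. (g has_real_derivative g' x) (at x)" "\<And>x. (g' has_real_derivative g'' x) (at x)"
    "continuous_on UNIV g''"
  shows "twice_cont_diff g"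
  using assms unfolding twice_cont_diff_def by blast

lemma twice_cont_diff_const: "twice_cont_diff (\<lambda>_. c)"
  by (rule twice_cont_diffI[of _ "\<lambda>_. 0" "\<lambda>_. 0"]) auto

lemma twice_cont_diff_cos: "twice_cont_diff cos"
  by (rule twice_cont_diffI[of _ "\<lambda>x. - sin x" "\<lambda>x. - cos x"])
     (auto intro!: derivative_eq_intros continuous_intros)

lemma twice_cont_diff_sin: "twice_cont_diff sin"
  by (rule twice_cont_diffI[of _ cos "\<lambda>x. - sin x"])
     (auto intro!: derivative_eq_intros continuous_intros)

lemma twice_cont_diff_add:
  assumes "twice_cont_diff f" "twice_cont_diff g"
  shows "twice_cont_diff (\<lambda>x. f x + g x)"
proof -
  obtain f' f'' where f: "\<And>x. (f has_real_derivative f' x) (at x)" "\<And>x. (f' has_real_derivative f'' x) (at x)"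
    "continuous_on UNIV f''" using assms(1) unfolding twice_cont_diff_def by blast
  obtain g' g'' where g: "\<And>x. (g has_real_derivative g' x) (at x)" "\<And>x. (g' has_real_derivative g'' x) (at x)"
    "continuous_on UNIV g''" using assms(2) unfolding twice_cont_diff_def by blast
  show ?thesis
    by (rule twice_cont_diffI[of _ "\<lambda>x. f' x + g' x" "\<lambda>x. f'' x + g'' x"])
       (intro DERIV_add f g continuous_intros)+
qed

lemma twice_cont_diff_mult:
  assumes "twice_cont_diff f" "twice_cont_diff g"
  shows "twice_cont_diff (\<lambda>x. f x * g x)"
proof -
  obtain f' f'' where f: "\<And>x. (f has_real_derivative f' x) (at x)" "\<And>x. (f' has_real_derivative f'' x) (at x)"
    "continuous_on UNIV f''" using assms(1) unfolding twice_cont_diff_def by blast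
  obtain g' g'' where g: "\<And>x. (g has_real_derivative g' x) (at x)" "\<And>x. (g' has_real_derivative g'' x) (at x)"
    "continuous_on UNIV g''" using assms(2) unfolding twice_cont_diff_def by blast
  have c: "continuous_on UNIV f" "continuous_on UNIV g" "continuous_on UNIV f'" "continuous_on UNIV g'"
    using f(1,2) g(1,2) by (auto intro!: continuous_at_imp_continuous_on DERIV_isCont)
  show ?thesis
    by (rule twice_cont_diffI[of _ "\<lambda>x. f' x * g x + g' x * f x"
          "\<lambda>x. (f'' x * g x + g' x * f' x) + (g'' x * f x + f' x * g' x)"])
       (intro DERIV_add DERIV_mult f g continuous_intros c)+
qed

lemma twice_cont_diff_power:
  "twice_cont_diff f \<Longrightarrow> twice_cont_diff (\<lambda>x. f x ^ i)"
  by (induction i) (simp_all add: twice_cont_diff_const twice_cont_diff_mult)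

lemma twice_cont_diff_sum:
  "(\<And>i. i \<in> I \<Longrightarrow> twice_cont_diff (f i)) \<Longrightarrow> twice_cont_diff (\<lambda>x. \<Sum>i\<in>I. f i x)"
  by (induction I rule: infinite_finite_induct) (simp_all add: twice_cont_diff_const twice_cont_diff_add)

lemma twice_cont_diff_continuous: "twice_cont_diff g \<Longrightarrow> continuous_on UNIV g"
  unfolding twice_cont_diff_def by (blast intro: continuous_at_imp_continuous_on DERIV_isCont)

text \<open>The minimum is compared with points across the ends of \<open>{0..pi}\<close>, so the
  derivative vanishes at \<open>\<theta>\<^sub>0\<close> even if that is an end point. A bound on
  the second derivative then controls first \<open>g'\<close> linearly and after that
  \<open>g\<close> quadratically.\<close>

lemma quadratic_bound_at_min:
  assumes g: "twice_cont_diff g" and \<theta>: "\<theta>\<^sub>0 \<in> {0..pi}"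
    and lmin: "\<And>\<theta>. \<bar>\<theta>\<^sub>0 - \<theta>\<bar> < 1 \<Longrightarrow> g \<theta>\<^sub>0 \<le> g \<theta>"
  obtains M where "M > 0" "\<And>\<theta>. \<theta> \<in> {0..pi} \<Longrightarrow> g \<theta> - g \<theta>\<^sub>0 \<le> M * (\<theta> - \<theta>\<^sub>0)\<^sup>2"
proof -
  obtain g' g'' where d: "\<And>x. (g has_real_derivative g' x) (at x)" "\<And>x. (g' has_real_derivative g'' x) (at x)"
    "continuous_on UNIV g''" using g unfolding twice_cont_diff_def by blast
  have g'0: "g' \<theta>\<^sub>0 = 0" using DERIV_local_min[OF d(1), of 1] lmin by auto
  have "bounded (g'' ` {0..pi})"
    by (intro compact_imp_bounded compact_continuous_image continuous_on_subset[OF d(3)]) auto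
  then obtain M where M: "M > 0" "\<And>x. x \<in> {0..pi} \<Longrightarrow> \<bar>g'' x\<bar> \<le> M"
    unfolding bounded_pos by auto
  have g'_le: "\<bar>g' x\<bar> \<le> M * \<bar>x - \<theta>\<^sub>0\<bar>" if "x \<in> {0..pi}" for x
  proof -
    have "norm (g' x - g' \<theta>\<^sub>0) \<le> M * norm (x - \<theta>\<^sub>0)"
      by (rule field_differentiable_bound[of "{0..pi}" g' g''])
         (use that \<theta> M(2) in \<open>auto intro: has_field_derivative_at_within[OF d(2)]\<close>)
    then show ?thesis by (simp add: g'0)
  qed
  have "g x - g \<theta>\<^sub>0 \<le> M * (x - \<theta>\<^sub>0)\<^sup>2" if x: "x \<in> {0..pi}" for x
  proof -
    have sub: "closed_segment \<theta>\<^sub>0 x \<subseteq> {0..pi}"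
      using x \<theta> by (intro closed_segment_subset) auto
    have "norm (g x - g \<theta>\<^sub>0) \<le> (M * \<bar>x - \<theta>\<^sub>0\<bar>) * norm (x - \<theta>\<^sub>0)"
    proof (rule field_differentiable_bound[of "closed_segment \<theta>\<^sub>0 x" g g'])
      fix z assume z: "z \<in> closed_segment \<theta>\<^sub>0 x"
      have "\<bar>z - \<theta>\<^sub>0\<bar> \<le> \<bar>x - \<theta>\<^sub>0\<bar>" using segment_bound(1)[OF z] by simp
      then have "M * \<bar>z - \<theta>\<^sub>0\<bar> \<le> M * \<bar>x - \<theta>\<^sub>0\<bar>" using M(1) by simp
      moreover have "\<bar>g' z\<bar> \<le> M * \<bar>z - \<theta>\<^sub>0\<bar>" using g'_le sub z by blast
      ultimately show "norm (g' z) \<le> M * \<bar>x - \<theta>\<^sub>0\<bar>" by simp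
    qed (auto intro: has_field_derivative_at_within[OF d(1)])
    also have "\<dots> = M * (x - \<theta>\<^sub>0)\<^sup>2"
      by (simp add: power2_eq_square abs_mult[symmetric] mult.assoc)
    finally show ?thesis by simp
  qed
  then show thesis using that M(1) by blast
qed

text \<open>At least one of the two intervals of length pi/2 adjacent to
  \<open>\<theta>\<^sub>0\<close> lies in \<open>{0..pi}\<close>, and there the lower bound has a
  logarithm as primitive. The estimate tends to infinity as \<open>d\<close> tends to 0.\<close>

lemma integral_ge_ln:
  assumes c: "c > 0" and A: "A > 0" and d: "d > 0" and \<theta>: "\<theta>\<^sub>0 \<in> {0..pi}"
    and f: "continuous_on {0..pi} f"
    and lb: "\<And>\<theta>. \<theta> \<in> {0..pi} \<Longrightarrow> c / (A * \<bar>\<theta> - \<theta>\<^sub>0\<bar> + d) \<le> f \<theta>"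
  shows "c / A * (ln (A * (pi / 2)) - ln d) \<le> integral {0..pi} f"
proof -
  have pos: "0 < A * \<bar>\<theta> - \<theta>\<^sub>0\<bar> + d" for \<theta> using A d by (simp add: add_nonneg_pos)
  have f0: "0 \<le> f \<theta>" if "\<theta> \<in> {0..pi}" for \<theta>
    using lb[OF that] pos[of \<theta>] c by (smt (verit) divide_nonneg_pos)
  have int: "f integrable_on {0..pi}" using f by (rule integrable_continuous_real)
  have ge: "c / A * (ln (A * (pi / 2) + d) - ln d) \<le> integral {0..pi} f"
    if J: "{\<alpha>..\<beta>} \<subseteq> {0..pi}" "\<alpha> \<le> \<beta>" and
      ftc: "((\<lambda>\<theta>. c / (A * \<bar>\<theta> - \<theta>\<^sub>0\<bar> + d)) has_integral c / A * (ln (A * (pi / 2) + d) - ln d)) {\<alpha>..\<beta>}"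
    for \<alpha> \<beta>
  proof -
    have fJ: "f integrable_on {\<alpha>..\<beta>}"
      using J f by (intro integrable_continuous_real continuous_on_subset[OF f])
    have "c / A * (ln (A * (pi / 2) + d) - ln d) \<le> integral {\<alpha>..\<beta>} f"
      by (rule has_integral_le[OF ftc integrable_integral[OF fJ]]) (use J lb in auto)
    also have "\<dots> \<le> integral {0..pi} f"
      by (rule integral_subset_le[OF J(1) fJ int]) (use f0 in auto)
    finally show ?thesis .
  qed
  have "c / A * (ln (A * (pi / 2) + d) - ln d) \<le> integral {0..pi} f"
  proof (cases "\<theta>\<^sub>0 \<le> pi / 2")
    case True
    define F where "F = (\<lambda>\<theta>. c / A * ln (A * (\<theta> - \<theta>\<^sub>0) + d))"
    have "((\<lambda>\<theta>. c / (A * \<bar>\<theta> - \<theta>\<^sub>0\<bar> + d)) has_integral F (\<theta>\<^sub>0 + pi / 2) - F \<theta>\<^sub>0) {\<theta>\<^sub>0..\<theta>\<^sub>0 + pi / 2}"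
    proof (rule fundamental_theorem_of_calculus)
      fix x assume "x \<in> {\<theta>\<^sub>0..\<theta>\<^sub>0 + pi / 2}"
      then have x: "\<bar>x - \<theta>\<^sub>0\<bar> = x - \<theta>\<^sub>0" by simp
      have "A * (x - \<theta>\<^sub>0) + d > 0" using pos[of x] x by simp
      then have "(F has_real_derivative c / (A * \<bar>x - \<theta>\<^sub>0\<bar> + d)) (at x)"
        unfolding F_def x using A by (auto intro!: derivative_eq_intros)
      then show "(F has_vector_derivative c / (A * \<bar>x - \<theta>\<^sub>0\<bar> + d)) (at x within {\<theta>\<^sub>0..\<theta>\<^sub>0 + pi / 2})"
        by (simp add: has_real_derivative_iff_has_vector_derivative has_vector_derivative_at_within)
    qed simp
    moreover have "F (\<theta>\<^sub>0 + pi / 2) = c / A * ln (A * (pi / 2) + d)" "F \<theta>\<^sub>0 = c / A * ln d"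
      by (simp_all add: F_def)
    ultimately show ?thesis
      using True \<theta> by (intro ge[of "\<theta>\<^sub>0" "\<theta>\<^sub>0 + pi / 2"]) (simp_all only: right_diff_distrib, auto)
  next
    case False
    define F where "F = (\<lambda>\<theta>. - (c / A * ln (A * (\<theta>\<^sub>0 - \<theta>) + d)))"
    have "((\<lambda>\<theta>. c / (A * \<bar>\<theta> - \<theta>\<^sub>0\<bar> + d)) has_integral F \<theta>\<^sub>0 - F (\<theta>\<^sub>0 - pi / 2)) {\<theta>\<^sub>0 - pi / 2..\<theta>\<^sub>0}"
    proof (rule fundamental_theorem_of_calculus)
      fix x assume "x \<in> {\<theta>\<^sub>0 - pi / 2..\<theta>\<^sub>0}"
      then have x: "\<bar>x - \<theta>\<^sub>0\<bar> = \<theta>\<^sub>0 - x" by simp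
      have "A * (\<theta>\<^sub>0 - x) + d > 0" using pos[of x] x by simp
      then have "(F has_real_derivative c / (A * \<bar>x - \<theta>\<^sub>0\<bar> + d)) (at x)"
        unfolding F_def x using A by (auto intro!: derivative_eq_intros)
      then show "(F has_vector_derivative c / (A * \<bar>x - \<theta>\<^sub>0\<bar> + d)) (at x within {\<theta>\<^sub>0 - pi / 2..\<theta>\<^sub>0})"
        by (simp add: has_real_derivative_iff_has_vector_derivative has_vector_derivative_at_within)
    qed simp
    moreover have "F (\<theta>\<^sub>0 - pi / 2) = - (c / A * ln (A * (pi / 2) + d))" "F \<theta>\<^sub>0 = - (c / A * ln d)"
      by (simp_all add: F_def)
    ultimately show ?thesis
      using False \<theta> by (intro ge[of "\<theta>\<^sub>0 - pi / 2" "\<theta>\<^sub>0"]) (simp_all only: right_diff_distrib, auto)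
  qed
  moreover have "ln (A * (pi / 2)) \<le> ln (A * (pi / 2) + d)"
    using A d by (subst ln_le_cancel_iff) (auto intro!: add_pos_pos mult_pos_pos)
  then have "c / A * (ln (A * (pi / 2)) - ln d) \<le> c / A * (ln (A * (pi / 2) + d) - ln d)"
    using A c by (intro mult_left_mono diff_right_mono) auto
  ultimately show ?thesis by linarith
qed

section \<open>The first critical value of \<open>P\<close>\<close>

lemma first_hitting_point:
  fixes f :: "real \<Rightarrow> real"
  assumes f: "continuous_on {0..b} f" and "f 0 < v" "v \<le> f b" "0 \<le> b"
  obtains p where "0 < p" "p \<le> b" "f p = v" "\<And>x. 0 \<le> x \<Longrightarrow> x < p \<Longrightarrow> f x < v"
proof -
  define S where "S = {x \<in> {0..b}. v \<le> f x}"
  have "closed S" unfolding S_def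
    using continuous_closed_preimage[OF f, of "{v..}"] by (simp add: vimage_def Int_def)
  then have "compact S" unfolding compact_eq_bounded_closed
    by (auto simp: S_def intro: bounded_subset[of "{0..b}"])
  moreover have "b \<in> S" using assms by (simp add: S_def)
  ultimately obtain p where p: "p \<in> S" "\<And>x. x \<in> S \<Longrightarrow> p \<le> x"
    using compact_attains_inf[of S] by blast
  have below: "f x < v" if "0 \<le> x" "x < p" for x
    using p(2)[of x] p(1) that by (force simp: S_def)
  have "p \<noteq> 0" using p(1) assms by (auto simp: S_def)
  then have p0: "0 < p" "p \<le> b" using p(1) by (auto simp: S_def)
  obtain x where x: "0 \<le> x" "x \<le> p" "f x = v"
    using IVT'[of f 0 v p] p(1) p0 assms continuous_on_subset[OF f, of "{0..p}"] by (auto simp: S_def)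
  then have "x = p" using below[of x] by force
  then show thesis using that p0 x below by blast
qed

lemma energy_power_nonneg:
  assumes "0 \<le> P" "0 \<le> 1 + 2 * a * P ^ k"
  shows "0 \<le> energy_power k a (P :: real)"
proof -
  have "P + 2 * a * P ^ Suc k = P * (1 + 2 * a * P ^ k)" by (simp add: algebra_simps)
  then show ?thesis unfolding energy_power_def using assms by simp
qed

text \<open>For \<open>a \<ge> 0\<close> the energy is at least \<open>P\<close>, so its power is
  unbounded. For \<open>a < 0\<close> it is bounded on the range where it is nonnegative, and its
  maximum is just large enough.\<close>

lemma energy_power_reaches_critical:
  assumes k: "k \<ge> 1" and \<mu>: "\<mu> > 0" "- \<mu> \<le> a"
  obtains P where "P > 0" "- crit_param k \<le> \<mu> * energy_power k a P"
    "\<And>Q. 0 \<le> Q \<Longrightarrow> Q \<le> P \<Longrightarrow> 0 \<le> energy_power k a (Q :: real)"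
proof (cases "a \<ge> 0")
  case True
  define P where "P = root k (- crit_param k / \<mu>)"
  have cp: "- crit_param k / \<mu> > 0" using crit_param_neg[OF k] \<mu> by (intro divide_pos_pos) auto
  have P: "P > 0" "P ^ k = - crit_param k / \<mu>"
    using k cp by (auto simp: P_def)
  have "P ^ k \<le> energy_power k a P"
    unfolding energy_power_def using True P(1) by (intro power_mono) auto
  then have "\<mu> * P ^ k \<le> \<mu> * energy_power k a P" using \<mu>(1) by simp
  moreover have "\<mu> * P ^ k = - crit_param k" using P(2) \<mu>(1) by simp
  ultimately have "- crit_param k \<le> \<mu> * energy_power k a P" by linarith
  moreover have "0 \<le> energy_power k a Q" if "0 \<le> Q" for Q :: real
    using that True by (intro energy_power_nonneg) auto
  ultimately show thesis using that P(1) by blast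
next
  case False
  \<comment> \<open>The maximum of \<open>P + 2 * a * P ^ Suc k\<close>, given by
    \<open>2 * (k + 1) * a * P ^ k = -1\<close>. There the energy is \<open>P * k / (k + 1)\<close>,
    so \<open>P\<close> divided by it is \<open>crit_radius k\<close>, and \<open>a\<close> times
    the energy power is exactly \<open>crit_param k\<close>.\<close>
  define P where "P = root k (1 / (2 * (real k + 1) * (- a)))"
  have cp: "1 / (2 * (real k + 1) * (- a)) > 0" using False by (intro divide_pos_pos mult_pos_pos) auto
  have P: "P > 0" "P ^ k = 1 / (2 * (real k + 1) * (- a))"
    using k cp by (auto simp: P_def)
  have aP: "2 * a * P ^ k = - 1 / (real k + 1)" 
  proof -
    have *: "2 * a * (1 / (2 * c * (- a))) = - 1 / c" if "c \<noteq> 0" for c :: real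
      using False that by (simp add: divide_simps)
    show ?thesis unfolding P(2) by (rule *) (use of_nat_0_le_iff[of k] in linarith)
  qed
  have fac: "1 + 2 * a * P ^ k = real k / (real k + 1)"
    unfolding aP by (simp add: field_simps)
  have "energy_power k a P = (P * (1 + 2 * a * P ^ k)) ^ k"
    by (simp add: energy_power_def algebra_simps)
  also have "\<dots> = P ^ k * (real k / (real k + 1)) ^ k" by (simp only: power_mult_distrib fac)
  finally have eP: "- a * energy_power k a P = (- a * P ^ k) * (real k / (real k + 1)) ^ k"
    by (simp only: mult.assoc)
  have "- a * P ^ k = 1 / (2 * (real k + 1))" using aP by (simp add: field_simps)
  then have eP': "- a * energy_power k a P = 1 / (2 * (real k + 1)) * (real k / (real k + 1)) ^ k"
    using eP by simp
  have "crit_param k = - (1 / (2 * (real k + 1)) * (real k / (real k + 1)) ^ k)"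
  proof -
    have "crit_param k = (1 - crit_radius k) / 2 * (1 / crit_radius k) ^ Suc k"
      by (simp add: crit_param_def level_param_def power_one_over field_simps)
    also have "1 / crit_radius k = real k / (real k + 1)" by (simp add: crit_radius_def)
    also have "(1 - crit_radius k) / 2 * (real k / (real k + 1)) ^ Suc k
      = ((1 - crit_radius k) / 2 * (real k / (real k + 1))) * (real k / (real k + 1)) ^ k" by simp
    also have "(1 - crit_radius k) / 2 * (real k / (real k + 1)) = - (1 / (2 * (real k + 1)))"
      using k by (simp add: crit_radius_def divide_simps)
    finally show ?thesis by simp
  qed
  then have "- crit_param k = - a * energy_power k a P" using eP' by simp
  also have "\<dots> \<le> \<mu> * energy_power k a P"
    using P(1) \<mu> fac by (intro mult_right_mono energy_power_nonneg) auto
  finally have "- crit_param k \<le> \<mu> * energy_power k a P" .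
  moreover have "0 \<le> energy_power k a Q" if "0 \<le> Q" "Q \<le> P" for Q :: real
  proof (rule energy_power_nonneg)
    have "2 * a * P ^ k \<le> 2 * a * Q ^ k"
      using that False by (intro mult_left_mono_neg power_mono) auto
    then show "0 \<le> 1 + 2 * a * Q ^ k" using fac by (smt (verit) divide_nonneg_nonneg of_nat_0_le_iff)
  qed fact
  ultimately show thesis using that P(1) by blast
qed

text \<open>Both neighbouring periods are included so that a minimiser at 0 or pi is a two-sided
  minimum.\<close>

lemma periodic_global_min:
  fixes g :: "real \<Rightarrow> real"
  assumes g: "continuous_on UNIV g" and per: "\<And>\<theta>. g (\<theta> + pi) = g \<theta>"
  obtains \<theta>\<^sub>0 where "\<theta>\<^sub>0 \<in> {0..pi}" "\<And>\<theta>. \<theta> \<in> {-pi..2*pi} \<Longrightarrow> g \<theta>\<^sub>0 \<le> g \<theta>"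
proof -
  obtain \<theta>\<^sub>0 where \<theta>: "\<theta>\<^sub>0 \<in> {0..pi}" "\<And>\<theta>. \<theta> \<in> {0..pi} \<Longrightarrow> g \<theta>\<^sub>0 \<le> g \<theta>"
    using continuous_attains_inf[of "{0..pi}" g] continuous_on_subset[OF g] by auto
  have "g \<theta>\<^sub>0 \<le> g \<theta>" if "\<theta> \<in> {-pi..2*pi}" for \<theta>
  proof -
    consider "\<theta> < 0" | "\<theta> \<in> {0..pi}" | "pi < \<theta>" using that by fastforce
    then show ?thesis using \<theta>(2)[of \<theta>] \<theta>(2)[of "\<theta> + pi"] \<theta>(2)[of "\<theta> - pi"] per[of \<theta>] per[of "\<theta> - pi"]
      by cases (use that in auto)
  qed
  then show thesis using that \<theta>(1) by blast
qed

text \<open>\<open>P\<close> is the first value at which the argument at the minimiser is critical.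
  Just below it, the excess of the argument over \<open>crit_param k\<close> is at most the square
  of \<open>A * \<bar>\<theta> - \<theta>\<^sub>0\<bar> + d\<close> with small \<open>d\<close>. The
  inverse square root bound for \<open>slowness\<close> thus becomes the reciprocal of a linear
  function, to which \<open>integral_ge_ln\<close> applies.\<close>

lemma half_period_blow_up:
  assumes k: "k \<ge> 1" and g: "twice_cont_diff g" and per: "\<And>\<theta>. g (\<theta> + pi) = g \<theta>"
    and neg: "\<theta>\<^sub>1 \<in> {0..pi}" "g \<theta>\<^sub>1 < 0"
  obtains P where "P > 0" "\<And>Q. 0 \<le> Q \<Longrightarrow> Q < P \<Longrightarrow> regular_up_to k g Q"
    "\<And>B. \<exists>Q. 0 < Q \<and> Q < P \<and> (\<forall>R. Q < R \<and> R < P \<longrightarrow> half_period k g R > B)"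
proof -
  have gc: "continuous_on UNIV g" using g by (rule twice_cont_diff_continuous)
  obtain \<theta>\<^sub>0 where \<theta>: "\<theta>\<^sub>0 \<in> {0..pi}" and gmin: "\<And>\<theta>. \<theta> \<in> {-pi..2*pi} \<Longrightarrow> g \<theta>\<^sub>0 \<le> g \<theta>"
    using periodic_global_min[OF gc per] by blast
  have "g \<theta>\<^sub>0 \<le> g \<theta>" if "\<bar>\<theta>\<^sub>0 - \<theta>\<bar> < 1" for \<theta>
    using that \<theta> pi_gt3 by (intro gmin) auto
  from quadratic_bound_at_min[OF g \<theta> this] obtain M where
    M: "M > 0" "\<And>\<theta>. \<theta> \<in> {0..pi} \<Longrightarrow> g \<theta> - g \<theta>\<^sub>0 \<le> M * (\<theta> - \<theta>\<^sub>0)\<^sup>2" by blast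
  define \<mu> where "\<mu> = - g \<theta>\<^sub>0"
  define v where "v = - crit_param k"
  define e where "e = (energy_power k (g 0) :: real \<Rightarrow> real)"
  have v: "v > 0" using crit_param_neg[OF k] by (simp add: v_def)
  have \<mu>: "\<mu> > 0" using gmin[of \<theta>\<^sub>1] neg by (simp add: \<mu>_def)
  have g\<mu>: "- \<mu> \<le> g \<theta>" if "\<theta> \<in> {0..pi}" for \<theta> using gmin[of \<theta>] that by (simp add: \<mu>_def)
  obtain P1 where P1: "P1 > 0" "v \<le> \<mu> * e P1" "\<And>Q. 0 \<le> Q \<Longrightarrow> Q \<le> P1 \<Longrightarrow> 0 \<le> e Q"
    using energy_power_reaches_critical[OF k \<mu> g\<mu>[of 0]] unfolding v_def e_def by auto
  have ec: "continuous_on A e" for A unfolding e_def by (intro continuous_intros)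
  obtain P where P: "0 < P" "P \<le> P1" "\<mu> * e P = v" "\<And>Q. 0 \<le> Q \<Longrightarrow> Q < P \<Longrightarrow> \<mu> * e Q < v"
  proof (rule first_hitting_point[of P1 "\<lambda>x. \<mu> * e x" v])
    show "continuous_on {0..P1} (\<lambda>x. \<mu> * e x)" by (intro continuous_intros ec)
    show "\<mu> * e 0 < v" using v k by (simp add: e_def)
  qed (use P1 in auto)
  have e0: "0 \<le> e Q" if "0 \<le> Q" "Q \<le> P" for Q using P1(3) that P(2) by auto
  have reg: "regular_up_to k g Q" if Q: "0 \<le> Q" "Q < P" for Q
    unfolding regular_up_to_def
  proof (intro ballI)
    fix R \<theta> assume R: "R \<in> {0..Q}" "\<theta> \<in> {0..pi}"
    have "- \<mu> * e R \<le> g \<theta> * e R" using g\<mu>[OF R(2)] e0[of R] R Q by (intro mult_right_mono) auto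
    moreover have "\<mu> * e R < v" using P(4)[of R] R Q by auto
    ultimately show "crit_param k < g \<theta> * energy_power k (g 0) R" by (simp add: v_def e_def)
  qed
  have "bounded (g ` {0..pi})"
    by (intro compact_imp_bounded compact_continuous_image continuous_on_subset[OF gc]) auto
  then obtain G where G: "G > 0" "\<And>\<theta>. \<theta> \<in> {0..pi} \<Longrightarrow> \<bar>g \<theta>\<bar> \<le> G"
    unfolding bounded_pos by auto
  define L where "L = e P"
  have L: "L > 0" using P(3) v \<mu> by (simp add: L_def zero_less_mult_iff flip: P(3))
  obtain c where c: "c > 0" "\<And>w. crit_param k < w \<Longrightarrow> w \<le> G * L \<Longrightarrow> slowness k w \<ge> c / sqrt (w - crit_param k)"
    using slowness_lower_bound[OF k, of "G * L"] by blast
  \<comment> \<open>The excess at \<theta> is at most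
    \<open>M * (\<theta> - \<theta>\<^sub>0)\<^sup>2 * L\<close> plus the excess at the minimiser;
    the square root of the first coefficient is the slope of the linear bound.\<close>
  define A where "A = sqrt (M * L)"
  have A: "A > 0" using M(1) L by (simp add: A_def)
  have lower: "c / A * (ln (A * (pi / 2)) - ln (sqrt (v - \<mu> * e Q))) \<le> half_period k g Q"
    if Q: "0 \<le> Q" "Q < P" for Q
    unfolding half_period_def
  proof (rule integral_ge_ln[OF c(1) A _ \<theta>])
    have eQ: "\<mu> * e Q < v" "0 \<le> e Q" using P(4) e0 Q by auto
    then have "\<mu> * e Q \<le> \<mu> * L" using P(3) by (simp add: L_def)
    then have eL: "e Q \<le> L" using \<mu> by simp
    show "0 < sqrt (v - \<mu> * e Q)" using eQ by simp
    show "continuous_on {0..pi} (\<lambda>\<theta>. slowness k (g \<theta> * energy_power k (g 0) Q))"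
      using half_period_integrand_continuous[OF k gc reg[OF Q], of Q] Q by auto
    fix \<theta> assume \<theta>': "\<theta> \<in> {0..pi}"
    let ?w = "g \<theta> * e Q"
    let ?d = "sqrt (v - \<mu> * e Q)"
    have w1: "crit_param k < ?w" using reg[OF Q] Q \<theta>' by (auto simp: regular_up_to_def e_def)
    have "?w \<le> G * e Q" using G(2)[OF \<theta>'] eQ(2) by (intro mult_right_mono) auto
    also have "\<dots> \<le> G * L" using eL G(1) by simp
    finally have w2: "?w \<le> G * L" .
    have "?w - crit_param k = (g \<theta> - g \<theta>\<^sub>0) * e Q + ?d\<^sup>2"
      using eQ by (simp add: v_def \<mu>_def algebra_simps)
    also have "\<dots> \<le> (M * (\<theta> - \<theta>\<^sub>0)\<^sup>2) * L + ?d\<^sup>2"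
      using M(2)[OF \<theta>'] eQ(2) eL M(1) by (intro add_right_mono mult_mono) auto
    also have "\<dots> = (A * \<bar>\<theta> - \<theta>\<^sub>0\<bar>)\<^sup>2 + ?d\<^sup>2"
      using M(1) L by (simp add: A_def power_mult_distrib)
    also have "\<dots> \<le> (A * \<bar>\<theta> - \<theta>\<^sub>0\<bar> + ?d)\<^sup>2"
      using A eQ by (simp add: power2_sum)
    finally have "sqrt (?w - crit_param k) \<le> A * \<bar>\<theta> - \<theta>\<^sub>0\<bar> + ?d"
      using A eQ by (intro real_le_lsqrt) auto
    then have "c / (A * \<bar>\<theta> - \<theta>\<^sub>0\<bar> + ?d) \<le> c / sqrt (?w - crit_param k)"
      using w1 c(1) A eQ by (intro divide_left_mono mult_pos_pos add_nonneg_pos) auto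
    also have "\<dots> \<le> slowness k ?w" by (rule c(2)[OF w1 w2])
    finally show "c / (A * \<bar>\<theta> - \<theta>\<^sub>0\<bar> + ?d) \<le> slowness k (g \<theta> * energy_power k (g 0) Q)"
      by (simp add: e_def)
  qed
  have "\<exists>Q. 0 < Q \<and> Q < P \<and> (\<forall>R. Q < R \<and> R < P \<longrightarrow> half_period k g R > B)" for B
  proof -
    \<comment> \<open>Solves
      \<open>c / A * (ln (A * (pi / 2)) - ln \<delta>) = B + 1\<close>.\<close>
    define \<delta> where "\<delta> = exp (ln (A * (pi / 2)) - (B + 1) * A / c)"
    have \<delta>: "\<delta> > 0" by (simp add: \<delta>_def)
    have "isCont (\<lambda>x. \<mu> * e x) P"
      using ec[of UNIV] by (intro continuous_intros) (simp add: continuous_on_eq_continuous_at)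
    then obtain s where s: "s > 0" "\<And>x. dist x P < s \<Longrightarrow> dist (\<mu> * e x) (\<mu> * e P) < \<delta>\<^sup>2"
      using \<delta> unfolding continuous_at_eps_delta by (metis zero_less_power)
    define Q where "Q = max (P / 2) (P - s)"
    have "half_period k g R > B" if R: "Q < R" "R < P" for R
    proof -
      have R0: "0 \<le> R" using R P(1) by (simp add: Q_def)
      have eR: "\<mu> * e R < v" using P(4)[OF R0 R(2)] .
      have "dist (\<mu> * e R) v < \<delta>\<^sup>2" using s(2)[of R] R by (simp add: Q_def dist_real_def P(3))
      then have "v - \<mu> * e R < \<delta>\<^sup>2" by (simp add: dist_real_def)
      then have "sqrt (v - \<mu> * e R) < \<delta>" using \<delta> by (intro real_less_lsqrt) auto
      then have "ln (sqrt (v - \<mu> * e R)) < ln \<delta>" using eR \<delta> by (subst ln_less_cancel_iff) auto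
      then have "c / A * (ln (A * (pi / 2)) - ln \<delta>) \<le> c / A * (ln (A * (pi / 2)) - ln (sqrt (v - \<mu> * e R)))"
        using c(1) A by (intro mult_left_mono) auto
      also have "\<dots> \<le> half_period k g R" by (rule lower[OF R0 R(2)])
      finally show ?thesis using c(1) A by (simp add: \<delta>_def)
    qed
    then show ?thesis using P(1) s(1) by (intro exI[of _ Q]) (auto simp: Q_def)
  qed
  then show thesis using that P(1) reg by blast
qed

section \<open>Comparing the two half periods\<close>

lemma half_period_nonneg:
  assumes k: "k \<ge> 1" and g: "continuous_on UNIV g" and reg: "regular_up_to k g P" "0 \<le> P"
  shows "0 \<le> half_period k g P"
  unfolding half_period_def
proof (rule integral_nonneg)
  show "(\<lambda>\<theta>. slowness k (g \<theta> * energy_power k (g 0) P)) integrable_on {0..pi}"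
    using half_period_integrand_continuous[OF k g reg(1), of P] reg(2) by (intro integrable_continuous_real) auto
  show "0 \<le> slowness k (g \<theta> * energy_power k (g 0) P)" if "\<theta> \<in> {0..pi}" for \<theta>
    using slowness_pos[OF k] reg that by (force simp: regular_up_to_def intro: less_imp_le)
qed

lemma half_period_at_0: "k \<ge> 1 \<Longrightarrow> half_period k g 0 = pi"
  by (simp add: half_period_def slowness_0)

lemma regular_up_to_nonneg:
  assumes k: "k \<ge> 1" and g: "\<And>\<theta>. \<theta> \<in> {0..pi} \<Longrightarrow> 0 \<le> g \<theta>"
  shows "regular_up_to k g P"
  unfolding regular_up_to_def
proof (intro ballI)
  fix Q \<theta> assume Q: "Q \<in> {0..P}" "\<theta> \<in> {0..pi}"
  have "0 \<le> energy_power k (g 0) Q" using Q g[of 0] by (intro energy_power_nonneg) auto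
  then have "0 \<le> g \<theta> * energy_power k (g 0) Q" using g Q by simp
  then show "crit_param k < g \<theta> * energy_power k (g 0) Q" using crit_param_neg[OF k] by linarith
qed

text \<open>A nonnegative second half period cannot compensate for a first one above
  \<open>C\<close>. The second profile has to be regular only below the same \<open>P\<close>, so
  this covers whichever profile becomes critical first.\<close>

lemma half_period_sum_no_blow_up:
  assumes k: "k \<ge> 1" "l \<ge> 1" and gb: "twice_cont_diff g" "twice_cont_diff b"
    and per: "\<And>\<theta>. g (\<theta> + pi) = g \<theta>" and \<delta>: "\<delta> > 0" and P: "P > 0"
    and eq: "\<And>Q. 0 < Q \<Longrightarrow> Q < \<delta> \<Longrightarrow> half_period k g Q + half_period l b Q = C"
    and reg: "\<And>Q. 0 \<le> Q \<Longrightarrow> Q < P \<Longrightarrow> regular_up_to k g Q" "\<And>Q. 0 \<le> Q \<Longrightarrow> Q < P \<Longrightarrow> regular_up_to l b Q"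
    and blow: "\<And>B. \<exists>Q. 0 < Q \<and> Q < P \<and> (\<forall>R. Q < R \<and> R < P \<longrightarrow> half_period k g R > B)"
  shows False
proof -
  obtain Q where Q: "0 < Q" "Q < P" "\<And>R. Q < R \<Longrightarrow> R < P \<Longrightarrow> half_period k g R > C" using blow[of C] by blast
  define R where "R = (Q + P) / 2"
  have R: "Q < R" "R < P" "0 < R" using Q by (auto simp: R_def)
  note cont = twice_cont_diff_continuous[OF gb(1)] twice_cont_diff_continuous[OF gb(2)]
  have rR: "regular_up_to k g R" "regular_up_to l b R" using reg R by auto
  have "half_period k g R + half_period l b R = C"
    by (rule half_period_sum_continuation[OF k cont rR \<delta> R(3) eq]) (use R in auto)
  moreover have "0 \<le> half_period l b R" using half_period_nonneg[OF k(2) cont(2) rR(2)] R by simp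
  ultimately show False using Q(3)[OF R(1,2)] by simp
qed

lemma half_period_nonneg_profile:
  assumes k: "k \<ge> 1" and g: "twice_cont_diff g" and g0: "\<And>\<theta>. \<theta> \<in> {0..pi} \<Longrightarrow> 0 \<le> g \<theta>" and P: "P > 0"
  shows "half_period k g P \<le> pi" "half_period k g P = pi \<Longrightarrow> \<theta> \<in> {0..pi} \<Longrightarrow> g \<theta> = 0"
proof -
  let ?s = "\<lambda>\<theta>. slowness k (g \<theta> * energy_power k (g 0) P)"
  have gc: "continuous_on UNIV g" by (rule twice_cont_diff_continuous[OF g])
  have reg: "regular_up_to k g P" by (rule regular_up_to_nonneg[OF k g0])
  have e: "0 < energy_power k (g 0) P"
    using P g0[of 0] unfolding energy_power_def by (intro zero_less_power add_pos_nonneg) auto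
  have sc: "continuous_on {0..pi} ?s"
    using half_period_integrand_continuous[OF k gc reg, of P] P by auto
  have s1: "?s \<theta> \<le> 1" "?s \<theta> = 1 \<Longrightarrow> g \<theta> = 0" if "\<theta> \<in> {0..pi}" for \<theta>
  proof -
    have "0 \<le> g \<theta>" using g0 that .
    then consider "g \<theta> = 0" | "0 < g \<theta> * energy_power k (g 0) P" using e by fastforce
    then show "?s \<theta> \<le> 1" "?s \<theta> = 1 \<Longrightarrow> g \<theta> = 0"
      using slowness_less_1[OF k, of "g \<theta> * energy_power k (g 0) P"] slowness_0[OF k] by (cases; simp)+
  qed
  have int: "((\<lambda>\<theta>. 1 - ?s \<theta>) has_integral (pi - half_period k g P)) {0..pi}"
    unfolding half_period_def
    using has_integral_diff[OF has_integral_const_real[of "1::real" 0 pi] integrable_integral[OF integrable_continuous_real[OF sc]]]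
    by simp
  show "half_period k g P \<le> pi"
    using has_integral_nonneg[OF int] s1(1) by simp
  assume "half_period k g P = pi" and \<theta>: "\<theta> \<in> {0..pi}"
  then have "((\<lambda>\<theta>. 1 - ?s \<theta>) has_integral 0) (cbox 0 pi)" using int by simp
  then have "1 - ?s \<theta> = 0"
    by (intro has_integral_0_cbox_imp_0[where f = "\<lambda>\<theta>. 1 - ?s \<theta>" and a = 0 and b = pi])
       (use sc s1(1) \<theta> pi_gt_zero in \<open>auto intro!: continuous_intros simp del: pi_gt_zero\<close>)
  then show "g \<theta> = 0" using s1(2)[OF \<theta>] by simp
qed

lemma half_period_sum_constant_imp_zero:
  assumes k: "k \<ge> 1" "l \<ge> 1" and gb: "twice_cont_diff g" "twice_cont_diff b"
    and per: "\<And>\<theta>. g (\<theta> + pi) = g \<theta>" "\<And>\<theta>. b (\<theta> + pi) = b \<theta>" and \<delta>: "\<delta> > 0"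
    and eq: "\<And>Q. 0 < Q \<Longrightarrow> Q < \<delta> \<Longrightarrow> half_period k g Q + half_period l b Q = C"
    and \<theta>: "\<theta> \<in> {0..pi}"
  shows "g \<theta> = 0" "b \<theta> = 0"
proof -
  have eq': "half_period l b Q + half_period k g Q = C" if "0 < Q" "Q < \<delta>" for Q
    using eq[OF that] by simp
  have nonneg: "(\<forall>\<theta>\<in>{0..pi}. 0 \<le> g \<theta>) \<and> (\<forall>\<theta>\<in>{0..pi}. 0 \<le> b \<theta>)"
  proof (rule ccontr)
    assume "\<not> ?thesis"
    then consider
      (g) \<theta>1 where "\<theta>1 \<in> {0..pi}" "g \<theta>1 < 0" "\<forall>\<theta>\<in>{0..pi}. 0 \<le> b \<theta>"
    | (b) \<theta>2 where "\<theta>2 \<in> {0..pi}" "b \<theta>2 < 0" "\<forall>\<theta>\<in>{0..pi}. 0 \<le> g \<theta>"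
    | (gb) \<theta>1 \<theta>2 where "\<theta>1 \<in> {0..pi}" "g \<theta>1 < 0" "\<theta>2 \<in> {0..pi}" "b \<theta>2 < 0"
      by (meson not_le)
    then show False
    proof cases
      case g
      obtain P where P: "P > 0" "\<And>Q. 0 \<le> Q \<Longrightarrow> Q < P \<Longrightarrow> regular_up_to k g Q"
        "\<And>B. \<exists>Q. 0 < Q \<and> Q < P \<and> (\<forall>R. Q < R \<and> R < P \<longrightarrow> half_period k g R > B)"
        using half_period_blow_up[OF k(1) gb(1) per(1) g(1,2)] by metis
      show False
        by (rule half_period_sum_no_blow_up[OF k gb per(1) \<delta> P(1) eq P(2) regular_up_to_nonneg P(3)]) (use k g in auto)
    next
      case b
      obtain P where P: "P > 0" "\<And>Q. 0 \<le> Q \<Longrightarrow> Q < P \<Longrightarrow> regular_up_to l b Q"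
        "\<And>B. \<exists>Q. 0 < Q \<and> Q < P \<and> (\<forall>R. Q < R \<and> R < P \<longrightarrow> half_period l b R > B)"
        using half_period_blow_up[OF k(2) gb(2) per(2) b(1,2)] by metis
      show False
        by (rule half_period_sum_no_blow_up[OF k(2,1) gb(2,1) per(2) \<delta> P(1) eq' P(2) regular_up_to_nonneg P(3)]) (use k b in auto)
    next
      case gb: gb
      obtain P where P: "P > 0" "\<And>Q. 0 \<le> Q \<Longrightarrow> Q < P \<Longrightarrow> regular_up_to k g Q"
        "\<And>B. \<exists>Q. 0 < Q \<and> Q < P \<and> (\<forall>R. Q < R \<and> R < P \<longrightarrow> half_period k g R > B)"
        using half_period_blow_up[OF k(1) assms(3) per(1) gb(1,2)] by metis
      obtain P' where P': "P' > 0" "\<And>Q. 0 \<le> Q \<Longrightarrow> Q < P' \<Longrightarrow> regular_up_to l b Q"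
        "\<And>B. \<exists>Q. 0 < Q \<and> Q < P' \<and> (\<forall>R. Q < R \<and> R < P' \<longrightarrow> half_period l b R > B)"
        using half_period_blow_up[OF k(2) assms(4) per(2) gb(3,4)] by metis
      \<comment> \<open>Up to the smaller of \<open>P\<close> and \<open>P'\<close> both profiles
        are regular, and the half period to which the smaller value belongs blows up there.\<close>
      show False
      proof (cases "P \<le> P'")
        case True
        show False
          by (rule half_period_sum_no_blow_up[OF k assms(3,4) per(1) \<delta> P(1) eq P(2) P'(2) P(3)]) (use True in auto)
      next
        case False
        show False
          by (rule half_period_sum_no_blow_up[OF k(2,1) assms(4,3) per(2) \<delta> P'(1) eq' P'(2) P(2) P'(3)]) (use False in auto)
      qed
    qed
  qed
  have reg: "regular_up_to k g 1" "regular_up_to l b 1" using nonneg k by (auto intro: regular_up_to_nonneg)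
  note cont = twice_cont_diff_continuous[OF gb(1)] twice_cont_diff_continuous[OF gb(2)]
  have sum: "half_period k g Q + half_period l b Q = C" if "Q \<in> {0..1}" for Q
    by (rule half_period_sum_continuation[OF k cont reg \<delta> _ eq that]) auto
  \<comment> \<open>\<open>P = 0\<close> fixes the constant. With nonnegative profiles every
    positive \<open>P\<close> is within reach of the continuation, and 1 is an arbitrary
    choice.\<close>
  have "C = 2 * pi" using sum[of 0] k by (simp add: half_period_at_0)
  then have "half_period k g 1 + half_period l b 1 = 2 * pi" using sum[of 1] by simp
  moreover have "half_period k g 1 \<le> pi" "half_period l b 1 \<le> pi"
    using half_period_nonneg_profile(1)[of _ _ 1] k gb nonneg by auto
  ultimately have "half_period k g 1 = pi" "half_period l b 1 = pi" by auto
  then show "g \<theta> = 0" "b \<theta> = 0"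
    using half_period_nonneg_profile(2)[of _ _ 1 \<theta>] k gb nonneg \<theta> by auto
qed

section \<open>Homogeneous Hamiltonians\<close>

lemma homogeneous_polynomial_scale:
  assumes "homogeneous_polynomial d P"
  shows "P (r * x) (r * y) = r ^ d * P x y"
proof -
  obtain c where c: "\<And>x y. P x y = (\<Sum>i\<le>d. c i * x ^ i * y ^ (d - i))"
    using assms unfolding homogeneous_polynomial_def by blast
  have "c i * (r * x) ^ i * (r * y) ^ (d - i) = r ^ d * (c i * x ^ i * y ^ (d - i))" if "i \<le> d" for i
  proof -
    have "r ^ d = r ^ i * r ^ (d - i)" using that by (simp flip: power_add)
    then show ?thesis by (simp add: power_mult_distrib)
  qed
  then show ?thesis unfolding c sum_distrib_left by (intro sum.cong) auto
qed

lemma homogeneous_polynomial_bound: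
  assumes "homogeneous_polynomial d P"
  obtains G where "G \<ge> 0" "\<And>x y. \<bar>P x y\<bar> \<le> G * sqrt (x\<^sup>2 + y\<^sup>2) ^ d"
proof -
  obtain c where c: "\<And>x y. P x y = (\<Sum>i\<le>d. c i * x ^ i * y ^ (d - i))"
    using assms unfolding homogeneous_polynomial_def by blast
  show thesis
  proof (rule that[of "\<Sum>i\<le>d. \<bar>c i\<bar>"])
    fix x y :: real
    define r where "r = sqrt (x\<^sup>2 + y\<^sup>2)"
    have xy: "\<bar>x\<bar> \<le> r" "\<bar>y\<bar> \<le> r" by (simp_all add: r_def)
    have "\<bar>P x y\<bar> \<le> (\<Sum>i\<le>d. \<bar>c i * x ^ i * y ^ (d - i)\<bar>)" unfolding c by (rule sum_abs)
    also have "\<dots> \<le> (\<Sum>i\<le>d. \<bar>c i\<bar> * r ^ d)"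
    proof (rule sum_mono)
      fix i assume "i \<in> {..d}"
      then have "r ^ d = r ^ i * r ^ (d - i)" by (simp flip: power_add)
      moreover have "\<bar>x\<bar> ^ i * \<bar>y\<bar> ^ (d - i) \<le> r ^ i * r ^ (d - i)"
        using xy by (intro mult_mono power_mono) auto
      ultimately have "\<bar>c i\<bar> * (\<bar>x\<bar> ^ i * \<bar>y\<bar> ^ (d - i)) \<le> \<bar>c i\<bar> * r ^ d"
        by (intro mult_left_mono) auto
      then show "\<bar>c i * x ^ i * y ^ (d - i)\<bar> \<le> \<bar>c i\<bar> * r ^ d"
        by (simp add: abs_mult power_abs mult.assoc)
    qed
    finally show "\<bar>P x y\<bar> \<le> (\<Sum>i\<le>d. \<bar>c i\<bar>) * sqrt (x\<^sup>2 + y\<^sup>2) ^ d"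
      by (simp add: r_def sum_distrib_right)
  qed (simp add: sum_nonneg)
qed

definition partial_x :: "(real \<Rightarrow> real \<Rightarrow> real) \<Rightarrow> real \<Rightarrow> real \<Rightarrow> real" where
  "partial_x P x y = deriv (\<lambda>u. P u y) x"

definition partial_y :: "(real \<Rightarrow> real \<Rightarrow> real) \<Rightarrow> real \<Rightarrow> real \<Rightarrow> real" where
  "partial_y P x y = deriv (P x) y"

lemma
  assumes "homogeneous_polynomial d P"
  shows homogeneous_polynomial_chain:
    "\<And>x y x' y' t S. (x has_real_derivative x') (at t within S) \<Longrightarrow> (y has_real_derivative y') (at t within S) \<Longrightarrow>
       ((\<lambda>t. P (x t) (y t)) has_real_derivative partial_x P (x t) (y t) * x' + partial_y P (x t) (y t) * y') (at t within S)"
    and homogeneous_polynomial_euler: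
    "\<And>x y. x * partial_x P x y + y * partial_y P x y = real d * P x y"
    and partial_x_scale: "\<And>r x y. partial_x P (r * x) (r * y) = r ^ (d - 1) * partial_x P x y"
    and partial_y_scale: "\<And>r x y. partial_y P (r * x) (r * y) = r ^ (d - 1) * partial_y P x y"
proof -
  obtain c where c: "\<And>x y. P x y = (\<Sum>i\<le>d. c i * x ^ i * y ^ (d - i))"
    using assms unfolding homogeneous_polynomial_def by blast
  \<comment> \<open>The truncated exponents are harmless: whenever \<open>i - 1\<close> or
    \<open>d - i - 1\<close> is cut off, the factor \<open>real i\<close> or
    \<open>real (d - i)\<close> is 0.\<close>
  define Px where "Px = (\<lambda>x y. \<Sum>i\<le>d. c i * (real i * x ^ (i - 1)) * y ^ (d - i))"
  define Py where "Py = (\<lambda>x y. \<Sum>i\<le>d. c i * x ^ i * (real (d - i) * y ^ (d - i - 1)))"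
  have chain: "((\<lambda>t. P (x t) (y t)) has_real_derivative Px (x t) (y t) * x' + Py (x t) (y t) * y') (at t within S)"
    if x: "(x has_real_derivative x') (at t within S)" and y: "(y has_real_derivative y') (at t within S)" for x y x' y' t S
  proof -
    have "((\<lambda>t. \<Sum>i\<le>d. c i * (x t ^ i * y t ^ (d - i))) has_real_derivative
      (\<Sum>i\<le>d. c i * (real i * (x' * x t ^ (i - Suc 0)) * y t ^ (d - i)
        + real (d - i) * (y' * y t ^ (d - i - Suc 0)) * x t ^ i))) (at t within S)"
      by (intro DERIV_sum DERIV_cmult DERIV_mult DERIV_power x y)
    also have "(\<Sum>i\<le>d. c i * (real i * (x' * x t ^ (i - Suc 0)) * y t ^ (d - i)
        + real (d - i) * (y' * y t ^ (d - i - Suc 0)) * x t ^ i)) = Px (x t) (y t) * x' + Py (x t) (y t) * y'"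
      unfolding Px_def Py_def sum_distrib_right sum.distrib[symmetric]
      by (intro sum.cong) (auto simp: algebra_simps)
    finally show ?thesis unfolding c by (simp only: mult.assoc)
  qed
  have dx: "partial_x P = Px"
    using chain[of "\<lambda>u. u" 1 _ UNIV "\<lambda>_. _" 0] by (intro ext) (simp add: partial_x_def DERIV_imp_deriv)
  have dy: "partial_y P = Py"
    using chain[of "\<lambda>_. _" 0 _ UNIV "\<lambda>u. u" 1] by (intro ext) (simp add: partial_y_def DERIV_imp_deriv)
  show "((\<lambda>t. P (x t) (y t)) has_real_derivative partial_x P (x t) (y t) * x' + partial_y P (x t) (y t) * y') (at t within S)"
    if "(x has_real_derivative x') (at t within S)" "(y has_real_derivative y') (at t within S)" for x y x' y' t S
    unfolding dx dy by (rule chain[OF that])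
  show "x * partial_x P x y + y * partial_y P x y = real d * P x y" for x y
  proof -
    have "x * (c i * (real i * x ^ (i - 1)) * y ^ (d - i)) + y * (c i * x ^ i * (real (d - i) * y ^ (d - i - 1)))
       = real d * (c i * x ^ i * y ^ (d - i))" if i: "i \<le> d" for i
    proof -
      have 1: "x * (real i * x ^ (i - 1)) = real i * x ^ i" by (cases i) auto
      have 2: "y * (real (d - i) * y ^ (d - i - 1)) = real (d - i) * y ^ (d - i)" by (cases "d - i") auto
      have "x * (c i * (real i * x ^ (i - 1)) * y ^ (d - i)) + y * (c i * x ^ i * (real (d - i) * y ^ (d - i - 1)))
        = c i * y ^ (d - i) * (x * (real i * x ^ (i - 1))) + c i * x ^ i * (y * (real (d - i) * y ^ (d - i - 1)))"
        by (simp only: mult_ac)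
      also have "\<dots> = (real i + real (d - i)) * (c i * x ^ i * y ^ (d - i))"
        unfolding 1 2 by (simp only: algebra_simps)
      also have "real i + real (d - i) = real d" using i by simp
      finally show ?thesis .
    qed
    then show ?thesis
      unfolding dx dy c Px_def Py_def sum_distrib_left sum.distrib[symmetric] by (intro sum.cong) auto
  qed
  show "partial_x P (r * x) (r * y) = r ^ (d - 1) * partial_x P x y" for r x y
  proof -
    have "c i * (real i * (r * x) ^ (i - 1)) * (r * y) ^ (d - i) = r ^ (d - 1) * (c i * (real i * x ^ (i - 1)) * y ^ (d - i))"
      if "i \<le> d" for i
    proof (cases "i = 0")
      case False
      then have "r ^ (d - 1) = r ^ (i - 1) * r ^ (d - i)" using that by (simp flip: power_add)
      then show ?thesis by (simp add: power_mult_distrib)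
    qed simp
    then show ?thesis unfolding dx Px_def sum_distrib_left by (intro sum.cong) auto
  qed
  show "partial_y P (r * x) (r * y) = r ^ (d - 1) * partial_y P x y" for r x y
  proof -
    have "c i * (r * x) ^ i * (real (d - i) * (r * y) ^ (d - i - 1)) = r ^ (d - 1) * (c i * x ^ i * (real (d - i) * y ^ (d - i - 1)))"
      if "i \<le> d" for i
    proof (cases "i = d")
      case False
      then have "r ^ (d - 1) = r ^ i * r ^ (d - i - 1)" using that by (simp flip: power_add)
      then show ?thesis by (simp add: power_mult_distrib)
    qed simp
    then show ?thesis unfolding dy Py_def sum_distrib_left by (intro sum.cong) auto
  qed
qed

lemma homogeneous_polynomial_circle_profile:
  assumes "homogeneous_polynomial d P"
  shows "twice_cont_diff (\<lambda>\<theta>. P (cos \<theta>) (sin \<theta>))"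
proof -
  obtain c where c: "\<And>x y. P x y = (\<Sum>i\<le>d. c i * x ^ i * y ^ (d - i))"
    using assms unfolding homogeneous_polynomial_def by blast
  show ?thesis unfolding c
    by (intro twice_cont_diff_sum twice_cont_diff_mult twice_cont_diff_const twice_cont_diff_power
          twice_cont_diff_cos twice_cont_diff_sin)
qed

section \<open>The Hamiltonian field and its symmetries\<close>

lemma hamiltonian_field_eqI:
  assumes "\<And>x y. ((\<lambda>u. P u y) has_real_derivative Px x y) (at x)"
    "\<And>x y. (P x has_real_derivative Py x y) (at y)"
  shows "hamiltonian_field (\<lambda>x y. (x\<^sup>2 + y\<^sup>2) / 2 + P x y) (x, y) = (- (y + Py x y), x + Px x y)"
proof -
  have "((\<lambda>v. (x\<^sup>2 + v\<^sup>2) / 2 + P x v) has_real_derivative y + Py x y) (at y)"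
    by (auto intro!: derivative_eq_intros assms)
  moreover have "((\<lambda>u. (u\<^sup>2 + y\<^sup>2) / 2 + P u y) has_real_derivative x + Px x y) (at x)"
    by (auto intro!: derivative_eq_intros assms)
  ultimately show ?thesis by (simp add: hamiltonian_field_def DERIV_imp_deriv)
qed

lemma hamiltonian_field_eq:
  assumes "homogeneous_polynomial d P"
  shows "hamiltonian_field (\<lambda>x y. (x\<^sup>2 + y\<^sup>2) / 2 + P x y) (x, y) =
    (- (y + partial_y P x y), x + partial_x P x y)"
proof (rule hamiltonian_field_eqI)
  show "((\<lambda>u. P u y) has_real_derivative partial_x P x y) (at x)" for x y
    using homogeneous_polynomial_chain[OF assms, of "\<lambda>u. u" 1 x UNIV "\<lambda>_. y" 0] by simp
  show "(P x has_real_derivative partial_y P x y) (at y)" for x y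
    using homogeneous_polynomial_chain[OF assms, of "\<lambda>_. x" 0 y UNIV "\<lambda>u. u" 1] by simp
qed

text \<open>The partial derivatives have the odd degree \<open>d - 1\<close>. Consequently the
  reflection in the origin maps trajectories to trajectories without reversing time.\<close>

lemma hamiltonian_field_odd:
  assumes "homogeneous_polynomial d P" "even d" "d > 0"
  shows "hamiltonian_field (\<lambda>x y. (x\<^sup>2 + y\<^sup>2) / 2 + P x y) (- z) = - hamiltonian_field (\<lambda>x y. (x\<^sup>2 + y\<^sup>2) / 2 + P x y) z"
proof -
  have "odd (d - 1)" using assms by simp
  then have "partial_x P (- x) (- y) = - partial_x P x y" "partial_y P (- x) (- y) = - partial_y P x y" for x y
    using partial_x_scale[OF assms(1), of "-1" x y] partial_y_scale[OF assms(1), of "-1" x y] by simp_all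
  then show ?thesis by (cases z) (simp add: hamiltonian_field_eq[OF assms(1)])
qed

lemma hamiltonian_field_linear_quadratic:
  assumes "homogeneous_polynomial 2 P"
  shows "linear (hamiltonian_field (\<lambda>x y. (x\<^sup>2 + y\<^sup>2) / 2 + P x y))"
proof -
  obtain c where "\<And>x y. P x y = (\<Sum>i\<le>2. c i * x ^ i * y ^ (2 - i))"
    using assms unfolding homogeneous_polynomial_def by blast
  then have c: "P = (\<lambda>x y. c 0 * y\<^sup>2 + c 1 * x * y + c 2 * x\<^sup>2)"
    by (intro ext) (simp add: eval_nat_numeral)
  have "hamiltonian_field (\<lambda>x y. (x\<^sup>2 + y\<^sup>2) / 2 + P x y) =
    (\<lambda>(x, y). (- (y + (2 * c 0 * y + c 1 * x)), x + (c 1 * y + 2 * c 2 * x)))"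
  proof (intro ext, clarify)
    fix x y
    show "hamiltonian_field (\<lambda>x y. (x\<^sup>2 + y\<^sup>2) / 2 + P x y) (x, y) =
      (- (y + (2 * c 0 * y + c 1 * x)), x + (c 1 * y + 2 * c 2 * x))"
      by (rule hamiltonian_field_eqI) (unfold c, auto intro!: derivative_eq_intros)
  qed
  then show ?thesis by (auto intro!: linearI simp: algebra_simps)
qed

lemma hamiltonian_field_linear_zero:
  assumes "\<And>x y. P x y = 0"
  shows "linear (hamiltonian_field (\<lambda>x y. (x\<^sup>2 + y\<^sup>2) / 2 + P x y))"
proof -
  have "homogeneous_polynomial 2 P"
    unfolding homogeneous_polynomial_def using assms by (intro exI[of _ "\<lambda>_. 0"]) simp
  then show ?thesis by (rule hamiltonian_field_linear_quadratic)
qed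

text \<open>Serves for \<open>c = -1\<close>, the reflection for an odd field, and for positive
  \<open>c\<close>, the homotheties of a linear field.\<close>

lemma trajectory_arc_scaleR:
  assumes arc: "trajectory_arc F U a b T" and F: "\<And>z. F (c *\<^sub>R z) = c *\<^sub>R F z"
    and U: "\<And>z. z \<in> U \<Longrightarrow> c *\<^sub>R z \<in> V"
  shows "trajectory_arc F V (c *\<^sub>R a) (c *\<^sub>R b) T"
proof -
  obtain z where z: "0 < T" "z 0 = a" "z T = b"
    "\<And>t. t \<in> {0..T} \<Longrightarrow> (z has_vector_derivative F (z t)) (at t within {0..T})"
    "\<And>t. t \<in> {0<..<T} \<Longrightarrow> z t \<in> U"
    using arc unfolding trajectory_arc_def by blast
  show ?thesis unfolding trajectory_arc_def
  proof (intro conjI exI[of _ "\<lambda>t. c *\<^sub>R z t"] ballI)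
    fix t assume "t \<in> {0..T}"
    from bounded_linear.has_vector_derivative[OF bounded_linear_scaleR_right z(4)[OF this], of c]
    show "((\<lambda>t. c *\<^sub>R z t) has_vector_derivative F (c *\<^sub>R z t)) (at t within {0..T})" by (simp only: F)
  qed (use z U in auto)
qed

lemma homogeneous_vanishes_of_upper_circle:
  assumes "homogeneous_polynomial d P" "even d" and zero: "\<And>\<theta>. \<theta> \<in> {0..pi} \<Longrightarrow> P (cos \<theta>) (sin \<theta>) = 0" and "d > 0"
  shows "P x y = 0"
proof -
  have upper: "P x y = 0" if y: "0 \<le> y" for x y
  proof (cases "x = 0 \<and> y = 0")
    case True
    then show ?thesis using homogeneous_polynomial_scale[OF assms(1), of 0 x y] assms(4) by (auto simp: zero_power)
  next
    case False
    define r where "r = sqrt (x\<^sup>2 + y\<^sup>2)"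
    have r: "r > 0" "r\<^sup>2 = x\<^sup>2 + y\<^sup>2" using False by (auto simp: r_def sum_power2_gt_zero_iff)
    have "(x / r)\<^sup>2 + (y / r)\<^sup>2 = 1" using r False by (auto simp: power_divide simp flip: add_divide_distrib)
    then obtain t where t: "0 \<le> t" "t \<le> pi" "x / r = cos t" "y / r = sin t"
      using sincos_total_pi[of "y / r" "x / r"] y r by auto
    then have "x = r * cos t" "y = r * sin t" using r by (auto simp: field_simps)
    then have "P x y = r ^ d * P (cos t) (sin t)" using homogeneous_polynomial_scale[OF assms(1)] by simp
    then show ?thesis using zero t by simp
  qed
  show ?thesis
  proof (cases "0 \<le> y")
    case False
    have "P (-1 * - x) (-1 * - y) = (-1) ^ d * P (- x) (- y)" by (rule homogeneous_polynomial_scale[OF assms(1)])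
    then show ?thesis using upper[of "- y" "- x"] False by simp
  qed (rule upper)
qed

section \<open>The time of a half orbit\<close>

text \<open>Rotating the curve by -\<Theta> and dividing by its radius gives the point
  (\<open>a\<close>, \<open>b\<close>). It does not move, since \<Theta> turns with the angular
  speed of the curve, and it starts at (1, 0). This provides a continuous angle without gluing
  branches of an inverse tangent.\<close>

lemma polar_of_rotation:
  fixes x y :: "real \<Rightarrow> real"
  assumes x: "\<And>t. t \<in> {0..T} \<Longrightarrow> (x has_real_derivative x' t) (at t within {0..T})"
    and y: "\<And>t. t \<in> {0..T} \<Longrightarrow> (y has_real_derivative y' t) (at t within {0..T})"
    and \<Theta>: "\<And>t. t \<in> {0..T} \<Longrightarrow>
      (\<Theta> has_real_derivative (x t * y' t - y t * x' t) / ((x t)\<^sup>2 + (y t)\<^sup>2)) (at t within {0..T})"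
    and pos: "\<And>t. t \<in> {0..T} \<Longrightarrow> 0 < (x t)\<^sup>2 + (y t)\<^sup>2"
    and init: "x 0 > 0" "y 0 = 0" "\<Theta> 0 = 0" and t: "t \<in> {0..T}"
  shows "x t = sqrt ((x t)\<^sup>2 + (y t)\<^sup>2) * cos (\<Theta> t)" "y t = sqrt ((x t)\<^sup>2 + (y t)\<^sup>2) * sin (\<Theta> t)"
proof -
  define r where "r = (\<lambda>t. sqrt ((x t)\<^sup>2 + (y t)\<^sup>2))"
  define a where "a = (\<lambda>t. (x t * cos (\<Theta> t) + y t * sin (\<Theta> t)) / r t)"
  define b where "b = (\<lambda>t. (y t * cos (\<Theta> t) - x t * sin (\<Theta> t)) / r t)"
  have rpos: "r t > 0" "(r t)\<^sup>2 = (x t)\<^sup>2 + (y t)\<^sup>2" if "t \<in> {0..T}" for t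
    using pos[OF that] by (auto simp: r_def)
  have dr: "(r has_real_derivative (x t * x' t + y t * y' t) / r t) (at t within {0..T})" if "t \<in> {0..T}" for t
  proof -
    have "((\<lambda>t. (x t)\<^sup>2 + (y t)\<^sup>2) has_real_derivative 2 * (x t * x' t + y t * y' t)) (at t within {0..T})"
      by (auto intro!: derivative_eq_intros x y that simp: algebra_simps)
    from DERIV_chain'[OF this DERIV_real_sqrt[OF pos[OF that]]]
    have "(r has_real_derivative inverse (r t) / 2 * (2 * (x t * x' t + y t * y' t))) (at t within {0..T})"
      unfolding r_def .
    also have "inverse (r t) / 2 * (2 * (x t * x' t + y t * y' t)) = (x t * x' t + y t * y' t) / r t"
      using rpos(1)[OF that] by (simp add: field_simps)
    finally show ?thesis .
  qed
  have key: "x' t * (r t)\<^sup>2 = x t * (x t * x' t + y t * y' t) - y t * (x t * y' t - y t * x' t)"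
    "y' t * (r t)\<^sup>2 = y t * (x t * x' t + y t * y' t) + x t * (x t * y' t - y t * x' t)" if "t \<in> {0..T}" for t
    unfolding rpos(2)[OF that] by algebra+
  have "a t = a 0 \<and> b t = b 0"
  proof -
    have d0: "(a has_real_derivative 0) (at t within {0..T}) \<and> (b has_real_derivative 0) (at t within {0..T})"
      if "t \<in> {0..T}" for t
    proof -
      \<comment> \<open>\<open>D\<close> is the angular rate and \<open>E\<close> the logarithmic
        radial rate: the velocity is \<open>E\<close> times (x, y) plus \<open>D\<close> times (-y,
        x).\<close>
      define D where "D = (x t * y' t - y t * x' t) / (r t)\<^sup>2"
      define E where "E = (x t * x' t + y t * y' t) / (r t)\<^sup>2"
      have r0: "r t \<noteq> 0" using rpos(1)[OF that] by simp
      have x': "x' t = x t * E - y t * D" and y': "y' t = y t * E + x t * D"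
      proof -
        have "x' t = x' t * (r t)\<^sup>2 / (r t)\<^sup>2" "y' t = y' t * (r t)\<^sup>2 / (r t)\<^sup>2" using r0 by simp_all
        note h = this[unfolded key[OF that]]
        have aux: "(a * N - b * M) / q = a * (N / q) - b * (M / q)" "(a * N + b * M) / q = a * (N / q) + b * (M / q)"
          for a b N M q :: real by (simp_all add: add_divide_distrib diff_divide_distrib)
        show "x' t = x t * E - y t * D" "y' t = y t * E + x t * D"
          unfolding D_def E_def by (rule trans[OF h(1) aux(1)], rule trans[OF h(2) aux(2)])
      qed
      have dr': "(r has_real_derivative r t * E) (at t within {0..T})"
        using dr[OF that] r0 by (simp add: E_def power2_eq_square)
      have d\<Theta>: "(\<Theta> has_real_derivative D) (at t within {0..T})"
        using \<Theta>[OF that] by (simp add: D_def rpos(2)[OF that])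
      have dc: "((\<lambda>t. cos (\<Theta> t)) has_real_derivative - sin (\<Theta> t) * D) (at t within {0..T})"
        and ds: "((\<lambda>t. sin (\<Theta> t)) has_real_derivative cos (\<Theta> t) * D) (at t within {0..T})"
        by (auto intro!: derivative_eq_intros d\<Theta>)
      have "(a has_real_derivative
         ((x' t * cos (\<Theta> t) + (- sin (\<Theta> t) * D) * x t + (y' t * sin (\<Theta> t) + (cos (\<Theta> t) * D) * y t)) * r t
          - (x t * cos (\<Theta> t) + y t * sin (\<Theta> t)) * (r t * E)) / (r t * r t)) (at t within {0..T})"
        unfolding a_def by (intro DERIV_divide DERIV_add DERIV_mult x y dc ds dr' r0 that)
      moreover have "(b has_real_derivative
         ((y' t * cos (\<Theta> t) + (- sin (\<Theta> t) * D) * y t - (x' t * sin (\<Theta> t) + (cos (\<Theta> t) * D) * x t)) * r t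
          - (y t * cos (\<Theta> t) - x t * sin (\<Theta> t)) * (r t * E)) / (r t * r t)) (at t within {0..T})"
        unfolding b_def by (intro DERIV_divide DERIV_diff DERIV_add DERIV_mult x y dc ds dr' r0 that)
      ultimately show ?thesis unfolding x' y' by (simp add: algebra_simps)
    qed
    have "\<exists>c. \<forall>t\<in>{0..T}. a t = c" "\<exists>c. \<forall>t\<in>{0..T}. b t = c"
      by (intro has_field_derivative_zero_constant; use d0 in auto)+
    then show ?thesis using t by force
  qed
  moreover have "a 0 = 1" "b 0 = 0" using init by (simp_all add: a_def b_def r_def)
  ultimately have ab: "x t * cos (\<Theta> t) + y t * sin (\<Theta> t) = r t" "y t * cos (\<Theta> t) - x t * sin (\<Theta> t) = 0"
    using rpos(1)[OF t] by (simp_all add: a_def b_def)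
  have "x t = x t * ((cos (\<Theta> t))\<^sup>2 + (sin (\<Theta> t))\<^sup>2)" by simp
  also have "\<dots> = (x t * cos (\<Theta> t) + y t * sin (\<Theta> t)) * cos (\<Theta> t) - (y t * cos (\<Theta> t) - x t * sin (\<Theta> t)) * sin (\<Theta> t)"
    by algebra
  finally show "x t = sqrt ((x t)\<^sup>2 + (y t)\<^sup>2) * cos (\<Theta> t)" using ab by (simp add: r_def)
  have "y t = y t * ((cos (\<Theta> t))\<^sup>2 + (sin (\<Theta> t))\<^sup>2)" by simp
  also have "\<dots> = (x t * cos (\<Theta> t) + y t * sin (\<Theta> t)) * sin (\<Theta> t) + (y t * cos (\<Theta> t) - x t * sin (\<Theta> t)) * cos (\<Theta> t)"
    by algebra
  finally show "y t = sqrt ((x t)\<^sup>2 + (y t)\<^sup>2) * sin (\<Theta> t)" using ab by (simp add: r_def)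
qed

text \<open>For small \<open>p\<close> the perturbation can neither carry the trajectory far away
  nor stop its rotation, so the angle increases from 0 to pi and can replace time as the variable.
  By the energy relation, \<open>s / E\<close> is the branch value of
  \<open>g \<theta> * E ^ k\<close>, so the angular speed is the reciprocal of
  \<open>slowness\<close>.\<close>

lemma upper_arc_end_and_time:
  fixes P :: "real \<Rightarrow> real \<Rightarrow> real"
  assumes k: "k \<ge> 1" and hom: "homogeneous_polynomial (2 * (k + 1)) P"
  defines "g \<equiv> \<lambda>\<theta>. P (cos \<theta>) (sin \<theta>)"
  obtains \<delta> where "\<delta> > 0"
    "\<And>p q T. 0 < p \<Longrightarrow> p < \<delta> \<Longrightarrow> q < 0 \<Longrightarrow>
       trajectory_arc (hamiltonian_field (\<lambda>x y. (x\<^sup>2 + y\<^sup>2) / 2 + P x y)) upper_half_plane (p, 0) (q, 0) T \<Longrightarrow>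
       q = - p \<and> T = half_period k g (p\<^sup>2)"
proof -
  let ?X = "hamiltonian_field (\<lambda>x y. (x\<^sup>2 + y\<^sup>2) / 2 + P x y)"
  let ?Px = "partial_x P" and ?Py = "partial_y P"
  obtain G where G: "G \<ge> 0" "\<And>x y. \<bar>P x y\<bar> \<le> G * sqrt (x\<^sup>2 + y\<^sup>2) ^ (2 * (k + 1))"
    using homogeneous_polynomial_bound[OF hom] by blast
  have G': "\<bar>P x y\<bar> \<le> G * (x\<^sup>2 + y\<^sup>2) ^ (k + 1)" for x y
    using G(2)[of x y] by (simp only: power_mult) simp
  \<comment> \<open>Small enough that for squared radius at most \<kappa> the perturbation changes
    the angular speed 1 by at most 1/4, and twice the energy by at most a quarter of the squared
    radius.\<close>
  define \<kappa> where "\<kappa> = 1 / (8 * (G + 1) * (real k + 1))"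
  have \<kappa>: "0 < \<kappa>" "\<kappa> \<le> 1"
  proof -
    have "1 * 1 \<le> (8 * (G + 1)) * (real k + 1)" using G(1) by (intro mult_mono) auto
    then show "0 < \<kappa>" "\<kappa> \<le> 1" unfolding \<kappa>_def by (auto simp: divide_le_eq_1)
  qed
  have small: "2 * (real k + 1) * G * s ^ k \<le> 1 / 4" "2 * G * s ^ k \<le> 1 / 4" if s: "0 \<le> s" "s \<le> \<kappa>" for s
  proof -
    have "s ^ k \<le> s ^ 1" using s \<kappa> k by (intro power_decreasing) auto
    then have "s ^ k \<le> \<kappa>" using s by simp
    then have "2 * (real k + 1) * G * s ^ k \<le> 2 * (real k + 1) * G * \<kappa>"
      using G(1) by (intro mult_left_mono) auto
    also have "\<dots> = 1 / 4 * (G / (G + 1))" using G(1) by (simp add: \<kappa>_def divide_simps) (simp add: algebra_simps)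
    also have "\<dots> \<le> 1 / 4 * 1" using G(1) by (intro mult_left_mono) (auto simp: divide_le_eq_1)
    finally show 1: "2 * (real k + 1) * G * s ^ k \<le> 1 / 4" by simp
    have "2 * G * s ^ k = 2 * (1 * G * s ^ k)" by simp
    also have "\<dots> \<le> 2 * ((real k + 1) * G * s ^ k)"
      using G(1) s by (intro mult_left_mono mult_right_mono) auto
    also have "\<dots> = 2 * (real k + 1) * G * s ^ k" by (simp only: mult.assoc)
    also note 1
    finally show "2 * G * s ^ k \<le> 1 / 4" .
  qed
  have small': "\<bar>2 * P x y\<bar> \<le> 1 / 4 * (x\<^sup>2 + y\<^sup>2)" if "x\<^sup>2 + y\<^sup>2 \<le> \<kappa>" for x y
  proof -
    let ?s = "x\<^sup>2 + y\<^sup>2"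
    have "\<bar>2 * P x y\<bar> = 2 * \<bar>P x y\<bar>" by simp
    also have "\<dots> \<le> 2 * (G * ?s ^ (k + 1))" using G'[of x y] by (intro mult_left_mono) auto
    also have "\<dots> = (2 * G * ?s ^ k) * ?s" by (simp add: mult_ac)
    also have "\<dots> \<le> 1 / 4 * ?s" using small(2)[OF _ that] by (intro mult_right_mono) auto
    finally show ?thesis .
  qed
  have main: "q = - p \<and> T = half_period k g (p\<^sup>2)"
    if p: "0 < p" "p < sqrt \<kappa> / 2" and q: "q < 0" and arc: "trajectory_arc ?X upper_half_plane (p, 0) (q, 0) T" for p q T
  proof -
    obtain z where T: "0 < T" and z: "z 0 = (p, 0)" "z T = (q, 0)"
      "\<And>t. t \<in> {0..T} \<Longrightarrow> (z has_vector_derivative ?X (z t)) (at t within {0..T})"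
      "\<And>t. t \<in> {0<..<T} \<Longrightarrow> z t \<in> upper_half_plane"
      using arc unfolding trajectory_arc_def by blast
    define x where "x = (\<lambda>t. fst (z t))"
    define y where "y = (\<lambda>t. snd (z t))"
    define x' where "x' = (\<lambda>t. - (y t + ?Py (x t) (y t)))"
    define y' where "y' = (\<lambda>t. x t + ?Px (x t) (y t))"
    have Xz: "?X (z t) = (x' t, y' t)" for t
      using hamiltonian_field_eq[OF hom, of "x t" "y t"] by (simp add: x_def y_def x'_def y'_def)
    have dx: "(x has_real_derivative x' t) (at t within {0..T})" if "t \<in> {0..T}" for t
      using bounded_linear.has_vector_derivative[OF bounded_linear_fst z(3)[OF that]]
      unfolding x_def[symmetric] Xz by (simp add: has_real_derivative_iff_has_vector_derivative x_def)
    have dy: "(y has_real_derivative y' t) (at t within {0..T})" if "t \<in> {0..T}" for t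
      using bounded_linear.has_vector_derivative[OF bounded_linear_snd z(3)[OF that]]
      unfolding y_def[symmetric] Xz by (simp add: has_real_derivative_iff_has_vector_derivative y_def)
    have ends: "x 0 = p" "y 0 = 0" "x T = q" "y T = 0" using z by (simp_all add: x_def y_def)
    have ypos: "0 < y t" if "t \<in> {0<..<T}" for t
      using z(4)[OF that] by (auto simp: upper_half_plane_def y_def)
    define s where "s = (\<lambda>t. (x t)\<^sup>2 + (y t)\<^sup>2)"
    define E where "E = p\<^sup>2 + 2 * P p 0"
    have xc: "continuous_on {0..T} x" by (rule DERIV_continuous_on[OF dx])
    have yc: "continuous_on {0..T} y" by (rule DERIV_continuous_on[OF dy])
    have Pc: "continuous_on {0..T} (\<lambda>t. P (x t) (y t))"
      by (rule DERIV_continuous_on[OF homogeneous_polynomial_chain[OF hom dx dy]])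
    have sc: "continuous_on {0..T} s" unfolding s_def by (intro continuous_intros xc yc)
    have energy: "s t + 2 * P (x t) (y t) = E" if "t \<in> {0..T}" for t
    proof -
      have "\<exists>c. \<forall>t\<in>{0..T}. s t + 2 * P (x t) (y t) = c"
      proof (rule has_field_derivative_zero_constant)
        fix t assume t: "t \<in> {0..T}"
        have "((\<lambda>t. s t + 2 * P (x t) (y t)) has_real_derivative
          2 * (x' t * x t) + 2 * (y' t * y t) + 2 * (?Px (x t) (y t) * x' t + ?Py (x t) (y t) * y' t)) (at t within {0..T})"
          unfolding s_def
          by (intro DERIV_add DERIV_cmult homogeneous_polynomial_chain[OF hom] dx dy t) (auto intro!: derivative_eq_intros dx[OF t] dy[OF t])
        also have "2 * (x' t * x t) + 2 * (y' t * y t) + 2 * (?Px (x t) (y t) * x' t + ?Py (x t) (y t) * y' t) = 0"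
          by (simp add: x'_def y'_def algebra_simps)
        finally show "((\<lambda>t. s t + 2 * P (x t) (y t)) has_real_derivative 0) (at t within {0..T})" .
      qed simp
      then have "s t + 2 * P (x t) (y t) = s 0 + 2 * P (x 0) (y 0)" using that T by force
      then show ?thesis by (simp add: E_def s_def ends)
    qed
    have p\<kappa>: "4 * p\<^sup>2 < \<kappa>"
    proof -
      have "p\<^sup>2 < (sqrt \<kappa> / 2)\<^sup>2" using p by (intro power_strict_mono) auto
      then show ?thesis using \<kappa> by (simp add: power_divide)
    qed
    have E: "3 / 4 * p\<^sup>2 \<le> E" "E \<le> 5 / 4 * p\<^sup>2"
    proof -
      have "p\<^sup>2 \<le> \<kappa>" using p\<kappa> zero_le_power2[of p] by linarith
      then have "\<bar>2 * P p 0\<bar> \<le> 1 / 4 * p\<^sup>2" using small'[of p 0] by simp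
      then show "3 / 4 * p\<^sup>2 \<le> E" "E \<le> 5 / 4 * p\<^sup>2" unfolding E_def by linarith+
    qed
    have p2: "0 < p\<^sup>2" using p by simp
    have E0: "E > 0" using E(1) p2 by linarith
    \<comment> \<open>An energy barrier: at \<open>s = 4 * p\<^sup>2\<close> twice the energy would
      be at least \<open>3 * p\<^sup>2\<close>, but it is constant and at most
      \<open>5 / 4 * p\<^sup>2\<close>.\<close>
    have s4: "s t < 4 * p\<^sup>2" if t: "t \<in> {0..T}" for t
    proof (rule ccontr)
      assume "\<not> s t < 4 * p\<^sup>2"
      moreover have "s 0 \<le> 4 * p\<^sup>2" by (simp add: s_def ends)
      ultimately obtain u where u: "0 \<le> u" "u \<le> t" "s u = 4 * p\<^sup>2"
        using IVT'[of s 0 "4 * p\<^sup>2" t] continuous_on_subset[OF sc, of "{0..t}"] t by auto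
      have "\<bar>2 * P (x u) (y u)\<bar> \<le> 1 / 4 * s u"
        unfolding s_def by (rule small') (use u(3) p\<kappa> in \<open>simp add: s_def\<close>)
      then have "3 * p\<^sup>2 \<le> s u + 2 * P (x u) (y u)" unfolding u(3) by linarith
      moreover have "s u + 2 * P (x u) (y u) = E" using u t by (intro energy) simp
      ultimately show False using E(2) p2 by linarith
    qed
    have s\<kappa>: "s t \<le> \<kappa>" if "t \<in> {0..T}" for t using s4[OF that] p\<kappa> by simp
    have spos: "0 < s t" if t: "t \<in> {0..T}" for t
    proof (rule ccontr)
      assume "\<not> 0 < s t"
      moreover have "0 \<le> s t" by (simp add: s_def)
      ultimately have "s t = 0" by simp
      moreover have "\<bar>2 * P (x t) (y t)\<bar> \<le> 1 / 4 * s t"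
        unfolding s_def by (rule small') (use s\<kappa>[OF t] in \<open>simp add: s_def\<close>)
      ultimately show False using energy[OF t] E0 by simp
    qed
    define D where "D = (\<lambda>t. (x t * y' t - y t * x' t) / s t)"
    have D_eq: "D t = 1 + 2 * (real k + 1) * P (x t) (y t) / s t" if t: "t \<in> {0..T}" for t
    proof -
      have "x t * y' t - y t * x' t = s t + (x t * ?Px (x t) (y t) + y t * ?Py (x t) (y t))"
        by (simp add: x'_def y'_def s_def power2_eq_square algebra_simps)
      also have "\<dots> = s t + 2 * (real k + 1) * P (x t) (y t)" by (simp only: homogeneous_polynomial_euler[OF hom]) simp
      finally show ?thesis using spos[OF t] by (simp add: D_def field_simps)
    qed
    have Dc: "continuous_on {0..T} D"
    proof (rule continuous_on_eq)
      show "continuous_on {0..T} (\<lambda>t. 1 + 2 * (real k + 1) * P (x t) (y t) / s t)"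
        using spos by (intro continuous_intros Pc sc) force
    qed (simp add: D_eq)
    define \<Theta> where "\<Theta> = (\<lambda>t. integral {0..t} D)"
    have d\<Theta>: "(\<Theta> has_real_derivative D t) (at t within {0..T})" if "t \<in> {0..T}" for t
      unfolding \<Theta>_def by (rule integral_has_real_derivative[OF Dc that])
    have \<Theta>0: "\<Theta> 0 = 0" by (simp add: \<Theta>_def)
    have \<Theta>c: "continuous_on {0..T} \<Theta>" by (rule DERIV_continuous_on[OF d\<Theta>])
    have polar: "x t = sqrt (s t) * cos (\<Theta> t)" "y t = sqrt (s t) * sin (\<Theta> t)" if "t \<in> {0..T}" for t
      using polar_of_rotation[OF dx dy d\<Theta>[unfolded D_def s_def] _ _ _ \<Theta>0 that] spos p ends
      unfolding s_def by auto
    have Pg: "P (x t) (y t) = s t ^ (k + 1) * g (\<Theta> t)" if t: "t \<in> {0..T}" for t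
    proof -
      have "P (x t) (y t) = sqrt (s t) ^ (2 * (k + 1)) * g (\<Theta> t)"
        unfolding polar[OF t] g_def by (rule homogeneous_polynomial_scale[OF hom])
      also have "sqrt (s t) ^ (2 * (k + 1)) = s t ^ (k + 1)"
        using spos[OF t] by (simp only: power_mult) simp
      finally show ?thesis .
    qed
    have D_g: "D t = 1 + 2 * (real k + 1) * (s t ^ k * g (\<Theta> t))" if t: "t \<in> {0..T}" for t
      using spos[OF t] unfolding D_eq[OF t] Pg[OF t] by simp
    have gG: "\<bar>g \<theta>\<bar> \<le> G" for \<theta> using G'[of "cos \<theta>" "sin \<theta>"] by (simp add: g_def)
    have Dpos: "0 < D t" if t: "t \<in> {0..T}" for t
    proof -
      have "\<bar>2 * (real k + 1) * (s t ^ k * g (\<Theta> t))\<bar> = 2 * (real k + 1) * s t ^ k * \<bar>g (\<Theta> t)\<bar>"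
        using spos[OF t] by (simp add: abs_mult)
      also have "\<dots> \<le> 2 * (real k + 1) * s t ^ k * G"
        using spos[OF t] by (intro mult_left_mono gG) auto
      also have "\<dots> \<le> 1 / 4" using small(1)[of "s t"] spos[OF t] s\<kappa>[OF t] by (simp add: mult_ac)
      finally show ?thesis unfolding D_g[OF t] by linarith
    qed
    have mono: "\<Theta> t < \<Theta> u" if "0 \<le> t" "t < u" "u \<le> T" for t u
    proof (rule DERIV_pos_imp_increasing_open[OF that(2)])
      fix v assume v: "t < v" "v < u"
      then have vT: "v \<in> {0..T}" and vI: "v \<in> interior {0..T}" using that by auto
      have "(\<Theta> has_real_derivative D v) (at v)"
        using d\<Theta>[OF vT] unfolding at_within_interior[OF vI] .
      then show "\<exists>y. (\<Theta> has_real_derivative y) (at v) \<and> 0 < y" using Dpos[OF vT] by blast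
    next
      show "continuous_on {t..u} \<Theta>" by (rule continuous_on_subset[OF \<Theta>c]) (use that in auto)
    qed
    have T_mem: "T \<in> {0..T}" "0 \<in> {0..T}" using T by auto
    have \<Theta>T0: "0 < \<Theta> T" using mono[of 0 T] T \<Theta>0 by simp
    \<comment> \<open>Passing the angle pi before time \<open>T\<close> would put the trajectory on
      the switching line at an interior time.\<close>
    have "\<Theta> T \<le> pi"
    proof (rule ccontr)
      assume "\<not> \<Theta> T \<le> pi"
      then obtain t where t: "0 \<le> t" "t \<le> T" "\<Theta> t = pi"
        using IVT'[of \<Theta> 0 pi T] \<Theta>c \<Theta>0 T by auto
      then have "t \<noteq> 0" "t \<noteq> T" using \<Theta>0 \<open>\<not> \<Theta> T \<le> pi\<close> by auto
      then have "0 < y t" using ypos t by simp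
      then show False using polar(2)[of t] t by simp
    qed
    moreover have "sin (\<Theta> T) = 0" using polar(2)[OF T_mem(1)] ends spos[OF T_mem(1)] by simp
    ultimately have \<Theta>T: "\<Theta> T = pi" using \<Theta>T0 sin_gt_zero[of "\<Theta> T"] by force
    have range: "\<Theta> t \<in> {0..pi}" if t: "t \<in> {0..T}" for t
      using mono[of 0 t] mono[of t T] t \<Theta>0 \<Theta>T by (cases "t = 0"; cases "t = T") auto
    have E_eq: "E = p\<^sup>2 + 2 * g 0 * (p\<^sup>2) ^ Suc k"
      using Pg[OF T_mem(2)] by (simp add: E_def ends s_def \<Theta>0)
    have ep: "energy_power k (g 0) (p\<^sup>2) = E ^ k" by (simp add: energy_power_def E_eq)
    \<comment> \<open>Positive angular speed means that \<open>s t / E\<close> lies below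
      \<open>crit_radius k\<close>, so it is the root selected by \<open>branch\<close>.\<close>
    have br: "branch k (g (\<Theta> t) * E ^ k) = s t / E \<and> crit_param k < g (\<Theta> t) * E ^ k \<and>
       slowness k (g (\<Theta> t) * E ^ k) * D t = 1" if t: "t \<in> {0..T}" for t
    proof -
      let ?\<sigma> = "s t / E"
      have \<sigma>: "0 < ?\<sigma>" using spos[OF t] E0 by simp
      have en: "E = s t + 2 * g (\<Theta> t) * s t ^ Suc k" using energy[OF t] Pg[OF t] by (simp add: mult_ac)
      have D\<sigma>: "(real k + 1) / ?\<sigma> - real k = D t"
      proof -
        have "(real k + 1) / ?\<sigma> = (real k + 1) * (E / s t)" by simp
        also have "E / s t = 1 + 2 * (s t ^ k * g (\<Theta> t))"
          using spos[OF t] by (subst en) (simp add: field_simps)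
        finally show ?thesis unfolding D_g[OF t] by (simp add: algebra_simps)
      qed
      then have "real k < (real k + 1) / ?\<sigma>" using Dpos[OF t] by linarith
      moreover have "a < crit_radius k" if "0 < a" "real k < (real k + 1) / a" for a
        using that k by (simp add: crit_radius_def field_simps)
      ultimately have \<sigma>2: "?\<sigma> < crit_radius k" using \<sigma> by blast
      have lp: "level_param k ?\<sigma> = g (\<Theta> t) * E ^ k"
      proof -
        have "1 - ?\<sigma> = (E - s t) / E" using E0 by (simp add: diff_divide_distrib)
        also have "\<dots> = 2 * g (\<Theta> t) * s t ^ Suc k / E" using en by simp
        finally have "level_param k ?\<sigma> = (2 * g (\<Theta> t) * s t ^ Suc k / E) / (2 * (s t ^ Suc k / E ^ Suc k))"
          by (simp only: level_param_def power_divide)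
        also have "\<dots> = g (\<Theta> t) * E ^ k" using spos[OF t] E0 by simp
        finally show ?thesis .
      qed
      have b: "branch k (g (\<Theta> t) * E ^ k) = ?\<sigma>" using branch_eqI[OF k \<sigma> \<sigma>2] lp by simp
      moreover have "crit_param k < g (\<Theta> t) * E ^ k"
        using level_param_strict_decreasing[OF \<sigma> \<sigma>2 order_refl k] lp by (simp add: crit_param_def)
      moreover have "slowness k (g (\<Theta> t) * E ^ k) * D t = 1"
        unfolding slowness_def b D\<sigma> using Dpos[OF t] by simp
      ultimately show ?thesis by blast
    qed
    let ?f = "\<lambda>\<theta>. slowness k (g \<theta> * E ^ k)"
    have gc: "continuous_on UNIV g"
      unfolding g_def by (rule twice_cont_diff_continuous[OF homogeneous_polynomial_circle_profile[OF hom]])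
    \<comment> \<open>The orbit meets every direction, so the orbit itself supplies the bound at
      every angle.\<close>
    have crit: "crit_param k < g \<theta> * E ^ k" if \<theta>: "\<theta> \<in> {0..pi}" for \<theta>
    proof -
      obtain t where "0 \<le> t" "t \<le> T" "\<Theta> t = \<theta>"
        using IVT'[of \<Theta> 0 \<theta> T] \<theta> \<Theta>c \<Theta>0 \<Theta>T T by auto
      then show ?thesis using br[of t] by auto
    qed
    have fc: "continuous_on {0..pi} ?f"
      by (rule continuous_on_compose2[OF slowness_continuous[OF k]])
         (use crit in \<open>auto intro!: continuous_intros continuous_on_subset[OF gc]\<close>)
    \<comment> \<open>Change of variable from time to angle. The integrand on the time side is
      identically 1, so the same integral is \<open>T\<close>.\<close>
    have "((\<lambda>t. D t *\<^sub>R ?f (\<Theta> t)) has_integral integral {\<Theta> 0..\<Theta> T} ?f) {0..T}"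
      by (rule has_integral_substitution[of _ _ _ 0 pi]) (use T \<Theta>T0 \<Theta>0 range fc d\<Theta> in auto)
    then have "((\<lambda>t. D t *\<^sub>R ?f (\<Theta> t)) has_integral half_period k g (p\<^sup>2)) {0..T}"
      by (simp add: \<Theta>0 \<Theta>T half_period_def ep)
    moreover have "((\<lambda>t. D t *\<^sub>R ?f (\<Theta> t)) has_integral T) {0..T}"
    proof (rule has_integral_eq)
      show "((\<lambda>t. 1) has_integral T) {0..T}" using has_integral_const_real[of "1::real" 0 T] T by simp
    qed (use br in \<open>auto simp: mult.commute\<close>)
    ultimately have time: "T = half_period k g (p\<^sup>2)" using has_integral_unique by blast
    \<comment> \<open>Even degree: the directions 0 and pi have the same argument, hence the same
      branch value, which puts both ends of the arc at the same distance from the origin.\<close>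
    have gpi: "g pi = g 0"
      using homogeneous_polynomial_scale[OF hom, of "-1" 1 0] by (simp add: g_def)
    have "s T / E = s 0 / E"
      using br[OF T_mem(1)] br[OF T_mem(2)] by (simp add: \<Theta>0 \<Theta>T gpi)
    then have "s T = s 0" using E0 by simp
    then have "q\<^sup>2 = p\<^sup>2" by (simp add: s_def ends)
    then have "q = - p" using p q by (auto simp: power2_eq_iff)
    then show ?thesis using time by blast
  qed
  show thesis by (rule that[of "sqrt \<kappa> / 2"]) (use \<kappa> main in auto)
qed

section \<open>Closed orbits and isochronicity\<close>

text \<open>The reflection turns the lower arc into an upper one starting at \<open>- q > 0\<close>,
  so one analysis of upper arcs serves both fields.\<close>

lemma closed_orbit_arcs:
  assumes "closed_orbit Xp (hamiltonian_field (\<lambda>x y. (x\<^sup>2 + y\<^sup>2) / 2 + P x y)) p q Tp Tm"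
    and hom: "homogeneous_polynomial d P" "even d" "d > 0"
  shows "0 < p" "q < 0" "trajectory_arc Xp upper_half_plane (p, 0) (q, 0) Tp"
    "trajectory_arc (hamiltonian_field (\<lambda>x y. (x\<^sup>2 + y\<^sup>2) / 2 + P x y)) upper_half_plane (- q, 0) (- p, 0) Tm"
proof -
  let ?X = "hamiltonian_field (\<lambda>x y. (x\<^sup>2 + y\<^sup>2) / 2 + P x y)"
  show "0 < p" "q < 0" "trajectory_arc Xp upper_half_plane (p, 0) (q, 0) Tp"
    using assms(1) by (simp_all add: closed_orbit_def)
  have "trajectory_arc ?X lower_half_plane (q, 0) (p, 0) Tm"
    using assms(1) by (simp add: closed_orbit_def)
  then have "trajectory_arc ?X upper_half_plane ((-1) *\<^sub>R (q, 0)) ((-1) *\<^sub>R (p, 0)) Tm"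
    by (rule trajectory_arc_scaleR)
       (auto simp: hamiltonian_field_odd[OF hom] lower_half_plane_def upper_half_plane_def)
  then show "trajectory_arc ?X upper_half_plane (- q, 0) (- p, 0) Tm" by simp
qed

text \<open>The hypothesis \<open>not_piecewise_linear\<close> excludes genuine exceptions: if
  \<open>Hn\<close> and \<open>Hm\<close> are zero, the system is the linear center, in which every
  orbit has period 2 pi.\<close>

theorem proposition4:
  fixes n m :: nat
    and Hn Hm :: "real \<Rightarrow> real \<Rightarrow> real"
    and Xp Xm :: "real \<times> real \<Rightarrow> real \<times> real"
  assumes "1 \<le> m" and "m \<le> n"
    and "homogeneous_polynomial (n + 1) Hn"
    and "homogeneous_polynomial (m + 1) Hm"
    and "Xp = hamiltonian_field (\<lambda>x y. (x\<^sup>2 + y\<^sup>2) / 2 + Hn x y)"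
    and "Xm = hamiltonian_field (\<lambda>x y. (x\<^sup>2 + y\<^sup>2) / 2 + Hm x y)"
    and not_piecewise_linear: "\<not> (linear Xp \<and> linear Xm)"
    and "odd n" and "odd m"
  shows "\<not> isochronous_sigma_center Xp Xm"
proof
  assume iso: "isochronous_sigma_center Xp Xm"
  note homn = assms(3) and homm = assms(4)
  note Xp = assms(5) and Xm = assms(6)
  obtain k where n: "n = 2 * k + 1" using \<open>odd n\<close> by (elim oddE)
  obtain l where m: "m = 2 * l + 1" using \<open>odd m\<close> by (elim oddE)
  have even: "even (n + 1)" "even (m + 1)" using assms(8,9) by auto
  have lin_m: "linear Xm" if "l = 0"
    using hamiltonian_field_linear_quadratic[of Hm] homm that by (simp add: Xm m numeral_2_eq_2)
  \<comment> \<open>For \<open>n = 1\<close> also \<open>m = 1\<close>, since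
    \<open>m \<le> n\<close>, and both fields would be linear.\<close>
  have k: "k \<ge> 1"
  proof (rule ccontr)
    assume "\<not> k \<ge> 1"
    then have "k = 0" "l = 0" using assms(2) n m by auto
    moreover have "linear Xp"
      using hamiltonian_field_linear_quadratic[of Hn] homn \<open>k = 0\<close> by (simp add: Xp n numeral_2_eq_2)
    ultimately show False using lin_m not_piecewise_linear by blast
  qed
  define g where "g = (\<lambda>\<theta>. Hn (cos \<theta>) (sin \<theta>))"
  define b where "b = (\<lambda>\<theta>. Hm (cos \<theta>) (sin \<theta>))"
  have g: "twice_cont_diff g" and b: "twice_cont_diff b"
    unfolding g_def b_def
    using homogeneous_polynomial_circle_profile homn homm by blast+
  have gper: "g (\<theta> + pi) = g \<theta>" for \<theta>
    using homogeneous_polynomial_scale[OF homn, of "-1" "cos \<theta>" "sin \<theta>"] even(1) by (simp add: g_def)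
  have bper: "b (\<theta> + pi) = b \<theta>" for \<theta>
    using homogeneous_polynomial_scale[OF homm, of "-1" "cos \<theta>" "sin \<theta>"] even(2) by (simp add: b_def)
  have zero_n: "linear Xp" if "\<And>\<theta>. \<theta> \<in> {0..pi} \<Longrightarrow> g \<theta> = 0"
    unfolding Xp using homogeneous_vanishes_of_upper_circle[OF homn even(1)] that
    by (intro hamiltonian_field_linear_zero) (simp add: g_def)
  have zero_m: "linear Xm" if "\<And>\<theta>. \<theta> \<in> {0..pi} \<Longrightarrow> b \<theta> = 0"
    unfolding Xm using homogeneous_vanishes_of_upper_circle[OF homm even(2)] that
    by (intro hamiltonian_field_linear_zero) (simp add: b_def)
  obtain \<delta>0 where \<delta>0: "\<delta>0 > 0" "\<And>p. 0 < p \<Longrightarrow> p < \<delta>0 \<Longrightarrow> \<exists>q Tp Tm. closed_orbit Xp Xm p q Tp Tm"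
    using iso unfolding isochronous_sigma_center_def sigma_center_def by auto
  obtain \<delta>1 T where \<delta>1: "\<delta>1 > 0"
    "\<And>p q Tp Tm. 0 < p \<Longrightarrow> p < \<delta>1 \<Longrightarrow> closed_orbit Xp Xm p q Tp Tm \<Longrightarrow> Tp + Tm = T"
    using iso unfolding isochronous_sigma_center_def by auto
  have homn': "homogeneous_polynomial (2 * (k + 1)) Hn" using homn by (simp add: n)
  obtain \<delta>2 where \<delta>2: "\<delta>2 > 0" "\<And>p q T. 0 < p \<Longrightarrow> p < \<delta>2 \<Longrightarrow> q < 0 \<Longrightarrow>
       trajectory_arc Xp upper_half_plane (p, 0) (q, 0) T \<Longrightarrow> q = - p \<and> T = half_period k g (p\<^sup>2)"
    using upper_arc_end_and_time[OF k homn'] unfolding Xp g_def by blast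
  have arcs: "0 < p" "q < 0" "trajectory_arc Xp upper_half_plane (p, 0) (q, 0) Tp"
    "trajectory_arc Xm upper_half_plane (- q, 0) (- p, 0) Tm" if "closed_orbit Xp Xm p q Tp Tm" for p q Tp Tm
    using closed_orbit_arcs[OF that[unfolded Xm] homm even(2)] unfolding Xm by auto
  show False
  proof (cases "l = 0")
    case False
    then have l: "l \<ge> 1" by simp
    have homm': "homogeneous_polynomial (2 * (l + 1)) Hm" using homm by (simp add: m)
    obtain \<delta>3 where \<delta>3: "\<delta>3 > 0" "\<And>p q T. 0 < p \<Longrightarrow> p < \<delta>3 \<Longrightarrow> q < 0 \<Longrightarrow>
       trajectory_arc Xm upper_half_plane (p, 0) (q, 0) T \<Longrightarrow> q = - p \<and> T = half_period l b (p\<^sup>2)"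
      using upper_arc_end_and_time[OF l homm'] unfolding Xm b_def by blast
    define \<delta> where "\<delta> = min (min \<delta>0 \<delta>1) (min \<delta>2 \<delta>3)"
    have \<delta>: "\<delta> > 0" using \<delta>0 \<delta>1 \<delta>2 \<delta>3 by (simp add: \<delta>_def)
    have sum: "half_period k g Q + half_period l b Q = T" if Q: "0 < Q" "Q < \<delta>\<^sup>2" for Q
    proof -
      define p where "p = sqrt Q"
      have p: "0 < p" "p < \<delta>" "p\<^sup>2 = Q" using Q \<delta> by (auto simp: p_def intro: real_less_lsqrt)
      obtain q Tp Tm where co: "closed_orbit Xp Xm p q Tp Tm" using \<delta>0(2)[of p] p by (auto simp: \<delta>_def)
      have "q = - p \<and> Tp = half_period k g (p\<^sup>2)"
        using \<delta>2(2)[OF p(1) _ arcs(2,3)[OF co]] p by (simp add: \<delta>_def)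
      \<comment> \<open>Since \<open>q = - p\<close> is known by now, the reflected lower arc starts
        at \<open>(p, 0)\<close>.\<close>
      moreover from this have "Tm = half_period l b (p\<^sup>2)"
        using \<delta>3(2)[of p "- p" Tm] arcs(4)[OF co] p by (simp add: \<delta>_def)
      moreover have "Tp + Tm = T" using \<delta>1(2)[OF p(1) _ co] p by (simp add: \<delta>_def)
      ultimately show ?thesis by (simp add: p)
    qed
    have "g \<theta> = 0" "b \<theta> = 0" if "\<theta> \<in> {0..pi}" for \<theta>
      using half_period_sum_constant_imp_zero[OF k l g b gper bper zero_less_power[OF \<delta>, of 2] sum that] by auto
    then show False using zero_n zero_m not_piecewise_linear by blast
  next
    case True
    define \<delta> where "\<delta> = min (min \<delta>0 \<delta>1) \<delta>2"
    have \<delta>: "\<delta> > 0" using \<delta>0 \<delta>1 \<delta>2 by (simp add: \<delta>_def)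
    define p0 where "p0 = \<delta> / 2"
    have p0: "0 < p0" "p0 < \<delta>" using \<delta> by (auto simp: p0_def)
    obtain q0 Tp0 Tm0 where co0: "closed_orbit Xp Xm p0 q0 Tp0 Tm0"
      using \<delta>0(2)[of p0] p0 by (auto simp: \<delta>_def)
    have q0: "q0 = - p0" using \<delta>2(2)[OF p0(1) _ arcs(2,3)[OF co0]] p0 by (simp add: \<delta>_def)
    have lower0: "trajectory_arc Xm lower_half_plane (- p0, 0) (p0, 0) Tm0"
      using co0 by (simp add: closed_orbit_def q0)
    \<comment> \<open>The arcs of the linear field \<open>Xm\<close> are all rescalings of one of them, so its half period is constant.\<close>
    have lower: "trajectory_arc Xm lower_half_plane (- p, 0) (p, 0) Tm0" if p: "0 < p" for p
    proof -
      have "trajectory_arc Xm lower_half_plane ((p / p0) *\<^sub>R (- p0, 0)) ((p / p0) *\<^sub>R (p0, 0)) Tm0"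
        by (rule trajectory_arc_scaleR[OF lower0])
           (use p p0 in \<open>auto simp: linear_scale[OF lin_m[OF True]] lower_half_plane_def divide_less_0_iff mult_less_0_iff\<close>)
      then show ?thesis using p0 by simp
    qed
    \<comment> \<open>The zero profile, with constant half period pi, stands in for the linear lower
      field, so that the result on two profiles applies. Its index 1 is arbitrary among the positive
      ones.\<close>
    have sum: "half_period k g Q + half_period 1 (\<lambda>_. 0) Q = T - Tm0 + pi" if Q: "0 < Q" "Q < \<delta>\<^sup>2" for Q
    proof -
      define p where "p = sqrt Q"
      have p: "0 < p" "p < \<delta>" "p\<^sup>2 = Q" using Q \<delta> by (auto simp: p_def intro: real_less_lsqrt)
      obtain q Tp Tm where co: "closed_orbit Xp Xm p q Tp Tm" using \<delta>0(2)[of p] p by (auto simp: \<delta>_def)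
      have q: "q = - p" and Tp: "Tp = half_period k g (p\<^sup>2)"
        using \<delta>2(2)[OF p(1) _ arcs(2,3)[OF co]] p by (simp_all add: \<delta>_def)
      \<comment> \<open>The given lower arc may be exchanged for the rescaled one, because
        isochronicity constrains every closed orbit through \<open>(p, 0)\<close>. This makes the
        lower time independent of \<open>p\<close>.\<close>
      have "closed_orbit Xp Xm p (- p) Tp Tm0"
        using co lower[OF p(1)] p(1) by (simp add: closed_orbit_def q)
      then have "Tp + Tm0 = T" using \<delta>1(2)[OF p(1)] p by (simp add: \<delta>_def)
      moreover have "half_period 1 (\<lambda>_. 0) Q = pi" by (simp add: half_period_def slowness_0)
      ultimately show ?thesis using Tp p by simp
    qed
    have "g \<theta> = 0" if "\<theta> \<in> {0..pi}" for \<theta>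
      by (rule half_period_sum_constant_imp_zero(1)[OF k order_refl g twice_cont_diff_const gper refl
            zero_less_power[OF \<delta>, of 2] sum that])
    then show False using zero_n lin_m[OF True] not_piecewise_linear by blast
  qed
qed

end
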